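(* There is a constant $p_0$ such that the following holds for every prime $p\ge p_0$. Put $T=\varphi(p-1)-1$ and let $T=p_1^{e_1}\cdots p_r^{e_r}$ be the prime factorization of $T$ with pairwise distinct odd primes $p_1,\ldots,p_r$ and $e_i\ge 1$ for $i=1,\ldots,r$. Let $(s_n)$ be the $T$-periodic sequence over $\mathbb{F}_2$ with $s_n\equiv g_{n+1}+g_{n+2}\bmod 2$ for $n=0,1,\ldots,T-1$, where $1<g_1<g_2<\cdots<g_{\varphi(p-1)}<p-1$ are all primitive roots modulo $p$ in increasing order. Then the linear complexity $L(s_n)$ of $(s_n)$ satisfies $$L(s_n)\ge \min\left\{\mathrm{ord}_{p_1}(2),\ldots,\mathrm{ord}_{p_r}(2)\right\}+\varepsilon,$$ where $\varepsilon=1$ if $p\equiv 1\bmod 4$ and $\varepsilon=0$ if $p\equiv 3\bmod 4$. In particular, if $T$ is a prime and $2$ is a primitive root modulo $T$, then $L(s_n)=T$ if $p\equiv 1\bmod 4$, and $L(s_n)\ge T-1$ if $p\equiv 3\bmod 4$.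
   Context: $\varphi$ is Euler's totient function. For coprime integers $m$ and $q$, $\mathrm{ord}_m(q)$ denotes the multiplicative order of $q$ modulo $m$. Note that $T$ is odd and $T\ge 3$ for primes $p\ge 11$. The linear complexity $L(s_n)$ of a sequence over $\mathbb{F}_2$ is the length of the shortest linear feedback shift register generating it, i.e. the smallest $L\ge 0$ such that there are $c_0,\ldots,c_{L-1}\in\mathbb{F}_2$ with $s_{n+L}=c_{L-1}s_{n+L-1}+\cdots+c_0s_n$ for all $n\ge 0$. For a $T$-periodic sequence one has $L(s_n)=T-\deg(\gcd(X^T-1,S(X)))$, where $S(X)=\sum_{n=0}^{T-1}s_nX^n\in\mathbb{F}_2[X]$. *)

theory Defs
  imports "HOL-Library.Z2" "HOL-Number_Theory.Number_Theory"
begin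

(* For a purely periodic sequence the period itself is an admissible L, so the least
   value exists; L = 0 is admissible exactly for the zero sequence. *)
definition linear_complexity :: "(nat \<Rightarrow> 'a::field) \<Rightarrow> nat" where
  "linear_complexity s =
     (LEAST L. \<exists>c :: nat \<Rightarrow> 'a. \<forall>n. s (n + L) = (\<Sum>i<L. c i * s (n + i)))"

(* residue_primroot does not bound g; for prime p >= 5 the bounds below select exactly
   the least positive representatives of all primitive roots modulo p. *)
definition primitive_roots :: "nat \<Rightarrow> nat list" where
  "primitive_roots p = sorted_list_of_set {g. 1 < g \<and> g < p - 1 \<and> residue_primroot p g}"

(* The list is indexed from 0, so entries n and n + 1 are the primitive roots
   g_(n+1) and g_(n+2) when the roots are numbered g_1 < g_2 < ... *)
definition primroot_sequence :: "nat \<Rightarrow> nat \<Rightarrow> bit" where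
  "primroot_sequence p n =
     (let T = totient (p - 1) - 1; g = primitive_roots p; k = n mod T
      in of_nat (g ! k + g ! (k + 1)))"

end

theory Submission
  imports Defs Complex_Main
begin

text \<open>
  Let \<open>V\<close> be the space of solutions of the shortest recurrence of \<open>s\<close> that share its minimal
  period \<open>T'\<close>, let \<open>q\<close> be a prime factor of \<open>T'\<close> and \<open>W\<close> the subspace fixed by the shift by
  \<open>T'/q\<close>. The shift acts on \<open>V - W\<close> with orbits of size \<open>q\<close>, so \<open>q\<close> divides
  \<open>2 ^ dim V - 2 ^ dim W\<close> and the order of 2 modulo \<open>q\<close> is at most \<open>dim V - dim W\<close>. If the sum
  of \<open>s\<close> over a period is 1, then \<open>W\<close> contains the constant sequence 1. For the sequence of
  primitive roots this sum telescopes to \<open>g\<^sub>1 + g\<^sub>\<phi>\<close>, which equals \<open>p\<close> if \<open>p \<equiv> 1 (mod 4)\<close>,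
  since then the primitive roots are symmetric under negation.

  It remains to see that the sequence is not constant for large \<open>p\<close>. The bound \<open>\<surd>p\<close> for Jacobi
  sums gives the number of \<open>x\<close> with \<open>x\<close> and \<open>x + h\<close> both primitive roots up to
  \<open>O(4 ^ \<omega>(p - 1) \<surd>p)\<close>. The case \<open>h = 1\<close> yields two consecutive primitive roots of different
  parity, and a second moment argument excludes that the parities always alternate.
\<close>

subsection \<open>Linear recurrences over the field with two elements\<close>

text \<open>In characteristic 2 a nonempty set closed under addition is a subspace. Adjoining one
  vector \<open>v\<close> outside \<open>W\<close> doubles it to the union of \<open>W\<close> and
  \<open>v + W\<close>, and this is repeated until \<open>V\<close> is exhausted. The exponent
  \<open>k\<close> plays the role of dim V - dim W.\<close>

lemma card_eq_power2_mult_card: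
  fixes V W :: "(nat \<Rightarrow> bit) set"
  assumes "finite V" "W \<subseteq> V" "W \<noteq> {}"
    and "\<And>a b. a \<in> V \<Longrightarrow> b \<in> V \<Longrightarrow> (\<lambda>n. a n + b n) \<in> V"
    and "\<And>a b. a \<in> W \<Longrightarrow> b \<in> W \<Longrightarrow> (\<lambda>n. a n + b n) \<in> W"
  shows "\<exists>k. card V = 2 ^ k * card W"
  using assms(2,3,5)
proof (induction "card V - card W" arbitrary: W rule: less_induct)
  case less
  show ?case
  proof (cases "W = V")
    case True
    then show ?thesis by (intro exI[of _ 0]) auto
  next
    case False
    with less.prems obtain v where v: "v \<in> V" "v \<notin> W" by blast
    \<comment> \<open>Translation by \<open>v\<close>, an involution since
      \<open>v + v = 0\<close>.\<close>
    define f where "f = (\<lambda>a::nat \<Rightarrow> bit. \<lambda>n. v n + a n)"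
    have ff: "f (f a) = a" for a by (auto simp: f_def fun_eq_iff simp flip: add.assoc)
    have finW: "finite W" using less.prems assms(1) finite_subset by blast
    have disj: "W \<inter> f ` W = {}"
    proof (rule ccontr)
      assume "W \<inter> f ` W \<noteq> {}"
      then obtain a where a: "a \<in> W" "f a \<in> W" by blast
      have "(\<lambda>n. f a n + a n) \<in> W" using less.prems(3) a by blast
      moreover have "(\<lambda>n. f a n + a n) = v"
        by (auto simp: f_def fun_eq_iff add.assoc)
      ultimately show False using v by simp
    qed
    define W' where "W' = W \<union> f ` W"
    have inj: "inj_on f W" by (metis ff inj_onI)
    have cardW': "card W' = 2 * card W"
      unfolding W'_def using disj finW card_image[OF inj] by (subst card_Un_disjoint) auto
    have sub: "W' \<subseteq> V"
      unfolding W'_def f_def using less.prems(1) v(1) assms(4) by blast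
    have closed: "(\<lambda>n. a n + b n) \<in> W'" if "a \<in> W'" "b \<in> W'" for a b
    proof -
      have "a \<in> W \<or> f a \<in> W" "b \<in> W \<or> f b \<in> W" using that by (auto simp: W'_def ff)
      then have "(\<lambda>n. a n + b n) \<in> W \<or> (\<lambda>n. f a n + b n) \<in> W \<or> (\<lambda>n. a n + f b n) \<in> W
        \<or> (\<lambda>n. f a n + f b n) \<in> W" using less.prems(3) by blast
      moreover have "(\<lambda>n. f a n + b n) = f (\<lambda>n. a n + b n)" "(\<lambda>n. a n + f b n) = f (\<lambda>n. a n + b n)"
        "(\<lambda>n. f a n + f b n) = (\<lambda>n. a n + b n)"
        by (auto simp: f_def fun_eq_iff ac_simps simp flip: add.assoc)
      ultimately show ?thesis unfolding W'_def using ff by (metis UnI1 UnI2 image_eqI)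
    qed
    have pos: "card W > 0" using finW less.prems(2) by auto
    have "card W' \<le> card V" using sub assms(1) card_mono by blast
    then have "card V - card W' < card V - card W" using cardW' pos by linarith
    from less.hyps[OF this sub _ closed] less.prems(2) obtain k where "card V = 2 ^ k * card W'"
      unfolding W'_def by blast
    then have "card V = 2 ^ Suc k * card W" using cardW' by simp
    then show ?thesis by blast
  qed
qed

text \<open>The map acts on \<open>V\<close> like a cyclic group of order \<open>q\<close>. As
  \<open>q\<close> is prime, every orbit is either a single point or has exactly \<open>q\<close>
  elements, and the latter orbits partition the moved points.\<close>

lemma prime_dvd_card_moved_points:
  fixes \<sigma> :: "'a \<Rightarrow> 'a"
  assumes "finite V" "prime q" "\<sigma> ` V \<subseteq> V" "\<And>x. x \<in> V \<Longrightarrow> (\<sigma> ^^ q) x = x"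
  shows "q dvd card {x \<in> V. \<sigma> x \<noteq> x}"
proof -
  define M where "M = {x \<in> V. \<sigma> x \<noteq> x}"
  define orb where "orb = (\<lambda>x. (\<lambda>i. (\<sigma> ^^ i) x) ` {..<q})"
  have q: "q > 1" using assms(2) prime_gt_1_nat by blast
  have inV: "(\<sigma> ^^ i) x \<in> V" if "x \<in> V" for x i
    using that assms(3) by (induction i) auto
  have per: "(\<sigma> ^^ (q * k)) x = x" if "x \<in> V" for x k
    using that assms(4) by (induction k) (auto simp: funpow_add)
  have md: "(\<sigma> ^^ i) x = (\<sigma> ^^ (i mod q)) x" if "x \<in> V" for x i
    by (metis comp_apply funpow_add mod_mult_div_eq per that)
  \<comment> \<open>Since \<open>d\<close> is invertible modulo \<open>q\<close>, the map itself
    acts on \<open>x\<close> as a power of its \<open>d\<close>-th iterate.\<close>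
  have fixd: "\<sigma> x = x" if x: "x \<in> V" and d: "(\<sigma> ^^ d) x = x" "0 < d" "d < q" for x d
  proof -
    have "coprime d q" using assms(2) d
      by (metis coprime_commute nat_dvd_not_less prime_imp_coprime)
    then obtain a where a: "[d * a = 1] (mod q)" by (metis cong_solve_coprime_nat One_nat_def)
    have "(\<sigma> ^^ (d * a)) x = x" using d(1)
      by (induction a) (auto simp: funpow_add)
    moreover have "(\<sigma> ^^ (d * a)) x = (\<sigma> ^^ 1) x" using md[OF x, of "d * a"] a q
      by (simp add: cong_def)
    ultimately show ?thesis by simp
  qed
  have inj: "inj_on (\<lambda>i. (\<sigma> ^^ i) x) {..<q}" if x: "x \<in> M" for x
  proof (rule linorder_inj_onI')
    fix i j assume ij: "i \<in> {..<q}" "j \<in> {..<q}" "i < j"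
    show "(\<sigma> ^^ i) x \<noteq> (\<sigma> ^^ j) x"
    proof
      assume e: "(\<sigma> ^^ i) x = (\<sigma> ^^ j) x"
      have xV: "x \<in> V" using x M_def by simp
      have "(\<sigma> ^^ ((q - i) + j)) x = (\<sigma> ^^ ((q - i) + i)) x"
        by (simp only: funpow_add comp_apply e)
      also have "\<dots> = x" using ij assms(4)[OF xV] by simp
      also have "(q - i) + j = q + (j - i)" using ij by simp
      finally have "(\<sigma> ^^ (j - i)) x = x"
        using md[OF xV, of "q + (j - i)"] md[OF xV, of "j - i"] by simp
      from fixd[OF xV this] ij x show False by (auto simp: M_def)
    qed
  qed
  have inM: "(\<sigma> ^^ i) x \<in> M" if x: "x \<in> M" for x i
  proof -
    have xV: "x \<in> V" using x M_def by simp
    have "\<sigma> ((\<sigma> ^^ i) x) \<noteq> (\<sigma> ^^ i) x"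
    proof
      assume e: "\<sigma> ((\<sigma> ^^ i) x) = (\<sigma> ^^ i) x"
      have st: "(\<sigma> ^^ k) ((\<sigma> ^^ i) x) = (\<sigma> ^^ i) x" for k
        by (induction k) (auto simp: e)
      \<comment> \<open>Another \<open>i * (q - 1)\<close> steps complete \<open>i\<close> full
        turns and lead back to \<open>x\<close>; if the \<open>i\<close>-th iterate were fixed,
        these steps would stay there, so \<open>x\<close> would be fixed too.\<close>
      have "x = (\<sigma> ^^ (i * (q - 1) + i)) x" using per[OF xV, of i] q
        by (simp add: algebra_simps)
      also have "\<dots> = (\<sigma> ^^ i) x" by (simp add: funpow_add st del: funpow.simps)
      finally have "(\<sigma> ^^ i) x = x" by simp
      with e x show False by (simp add: M_def)
    qed
    then show ?thesis using inV[OF xV] by (simp add: M_def)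
  qed
  have orb_eq: "orb y = orb x" if x: "x \<in> M" and y: "y \<in> orb x" for x y
  proof -
    have xV: "x \<in> V" using x M_def by simp
    obtain i where i: "i < q" "y = (\<sigma> ^^ i) x" using y orb_def by auto
    \<comment> \<open>One inclusion suffices, because both orbits have \<open>q\<close>
      elements.\<close>
    have "orb y \<subseteq> orb x"
    proof
      fix z assume "z \<in> orb y"
      then obtain j where "z = (\<sigma> ^^ j) y" by (auto simp: orb_def)
      then have "z = (\<sigma> ^^ ((j + i) mod q)) x" using i md[OF xV] by (metis comp_apply funpow_add)
      then show "z \<in> orb x" using q by (auto simp: orb_def)
    qed
    moreover have "card (orb y) = q" "card (orb x) = q"
      unfolding orb_def using card_image[OF inj[OF x]] card_image[OF inj[OF inM[OF x, of i]]] i by auto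
    ultimately show ?thesis
      using card_subset_eq[of "orb x" "orb y"] by (simp add: orb_def)
  qed
  have U: "\<Union> (orb ` M) = M"
  proof
    show "\<Union> (orb ` M) \<subseteq> M" using inM by (auto simp: orb_def)
    show "M \<subseteq> \<Union> (orb ` M)"
    proof
      fix x assume "x \<in> M"
      moreover have "x \<in> orb x" using q by (auto simp: orb_def intro!: image_eqI[of _ _ 0])
      ultimately show "x \<in> \<Union> (orb ` M)" by blast
    qed
  qed
  have "finite M" using assms(1) M_def by simp
  then have "q * card (orb ` M) = card (\<Union> (orb ` M))"
  proof (intro card_partition)
    show "finite M \<Longrightarrow> finite (orb ` M)" "finite M \<Longrightarrow> finite (\<Union> (orb ` M))" using U by auto
    show "card c = q" if "c \<in> orb ` M" for c
      using that card_image[OF inj] by (auto simp: orb_def)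
    show "c1 \<inter> c2 = {}" if "c1 \<in> orb ` M" "c2 \<in> orb ` M" "c1 \<noteq> c2" for c1 c2
      using that orb_eq by (metis disjoint_iff imageE)
  qed
  then show ?thesis unfolding U M_def[symmetric] by (metis dvd_triv_left)
qed

text \<open>In contrast to \<open>linear_complexity\<close> the coefficients are a parameter: for
  fixed \<open>c\<close> the solutions form a vector space that is stable under shifts.\<close>

definition lin_rec :: "nat \<Rightarrow> (nat \<Rightarrow> 'a::field) \<Rightarrow> (nat \<Rightarrow> 'a) \<Rightarrow> bool" where
  "lin_rec L c s \<longleftrightarrow> (\<forall>n. s (n + L) = (\<Sum>i<L. c i * s (n + i)))"

lemma lin_rec_shift: "lin_rec L c s \<Longrightarrow> lin_rec L c (\<lambda>n. s (n + k))"
  unfolding lin_rec_def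
proof (intro allI)
  fix n assume "\<forall>n. s (n + L) = (\<Sum>i<L. c i * s (n + i))"
  from this[rule_format, of "n + k"] show "s (n + L + k) = (\<Sum>i<L. c i * s (n + i + k))"
    by (simp add: ac_simps)
qed

lemma lin_rec_add: "lin_rec L c s \<Longrightarrow> lin_rec L c t \<Longrightarrow> lin_rec L c (\<lambda>n. s n + t n)"
  by (simp add: lin_rec_def sum.distrib distrib_left)

lemma lin_rec_sum:
  "finite K \<Longrightarrow> (\<And>k. k \<in> K \<Longrightarrow> lin_rec L c (f k)) \<Longrightarrow> lin_rec L c (\<lambda>n. \<Sum>k\<in>K. f k n)"
proof (induction K rule: finite_induct)
  case empty
  then show ?case by (simp add: lin_rec_def)
next
  case (insert x F)
  then show ?case using lin_rec_add[of L c "f x"] by simp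
qed

text \<open>Every later term is computed from the \<open>L\<close> terms before it. Over the field
  with two elements this leaves at most \<open>2 ^ L\<close> solutions.\<close>

lemma lin_rec_eqI:
  assumes "lin_rec L c s" "lin_rec L c t" "\<And>n. n < L \<Longrightarrow> s n = t n"
  shows "s = t"
proof
  fix n show "s n = t n"
  proof (induction n rule: less_induct)
    case (less n)
    show ?case
    proof (cases "n < L")
      case False
      have "s (n - L + L) = (\<Sum>i<L. c i * s (n - L + i))"
        using assms(1) unfolding lin_rec_def by blast
      also have "\<dots> = (\<Sum>i<L. c i * t (n - L + i))"
        using less False by (intro sum.cong) auto
      also have "\<dots> = t (n - L + L)"
        using assms(2) unfolding lin_rec_def by metis
      finally show ?thesis using False by simp
    qed (use assms in auto)
  qed
qed

text \<open>Periodicity is itself a recurrence of length \<open>T\<close>, with coefficient 1 at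
  index 0 and 0 elsewhere, so the least length exists and is at most \<open>T\<close>.\<close>

lemma lin_rec_linear_complexity:
  assumes "T > 0" "\<And>n. s (n + T) = s n"
  shows "\<exists>c. lin_rec (linear_complexity s) c s" and "linear_complexity s \<le> T"
proof -
  have "s (n + T) = (\<Sum>i<T. of_bool (i = 0) * s (n + i))" for n
  proof -
    have "(\<Sum>i<T. of_bool (i = 0) * s (n + i)) = (\<Sum>i\<in>{0}. s (n + i))"
      using assms(1) by (intro sum.mono_neutral_cong_right) auto
    then show ?thesis using assms(2) by simp
  qed
  then have "lin_rec T (\<lambda>i. of_bool (i = 0)) s" by (simp add: lin_rec_def)
  then have *: "\<exists>c. lin_rec T c s" by blast
  then show "\<exists>c. lin_rec (linear_complexity s) c s" 
    unfolding linear_complexity_def lin_rec_def by (rule LeastI)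
  show "linear_complexity s \<le> T"
    using * unfolding linear_complexity_def lin_rec_def by (rule Least_le)
qed

lemma periodic_mult:
  fixes s :: "nat \<Rightarrow> 'a"
  assumes "\<And>n. s (n + T) = s n" shows "s (n + T * k) = s n"
proof (induction k)
  case (Suc k)
  then show ?case using assms[of "n + T * k"] by (simp add: ac_simps)
qed simp

text \<open>The prime \<open>q\<close> is any prime factor of the minimal period \<open>T'\<close>,
  which exceeds 1 because \<open>s\<close> is not constant. Minimality of \<open>T'\<close>
  guarantees that the shift by \<open>T' / q\<close> really moves \<open>s\<close>.\<close>

lemma linear_complexity_lower_bound:
  fixes s :: "nat \<Rightarrow> bit"
  assumes "odd T" and per: "\<And>n. s (n + T) = s n" and nonconst: "s m \<noteq> s 0"
  shows "\<exists>q\<in>prime_factors T. ord q 2 + of_bool ((\<Sum>n<T. s n) = 1) \<le> linear_complexity s"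
proof -
  define T' where "T' = (LEAST t. t > 0 \<and> (\<forall>n. s (n + t) = s n))"
  have T: "T > 0" using assms(1) by (cases T) auto
  have T': "T' > 0" "\<And>n. s (n + T') = s n" and le: "\<And>t. t > 0 \<Longrightarrow> (\<And>n. s (n + t) = s n) \<Longrightarrow> T' \<le> t"
    using LeastI[of "\<lambda>t. t > 0 \<and> (\<forall>n. s (n + t) = s n)" T] T per
      Least_le[of "\<lambda>t. t > 0 \<and> (\<forall>n. s (n + t) = s n)"]
    unfolding T'_def[symmetric] by auto
  have dvd: "T' dvd T"
  proof (rule ccontr)
    assume "\<not> T' dvd T"
    then have "T mod T' > 0" by (simp add: mod_greater_zero_iff_not_dvd)
    moreover have "s (n + T mod T') = s n" for n
    proof -
      have "s (n + T mod T') = s (n + T mod T' + T' * (T div T'))"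
        by (rule periodic_mult[of s T', OF T'(2), symmetric])
      also have "\<dots> = s (n + T)" by (metis add.assoc mod_mult_div_eq)
      finally show ?thesis using per by simp
    qed
    ultimately show False using le T'(1) by (meson leD mod_less_divisor)
  qed
  have "T' \<noteq> 1"
  proof
    assume "T' = 1"
    then have "s (0 + 1 * m) = s 0" using periodic_mult[of s 1 0 m] T'(2) by simp
    then show False using nonconst by simp
  qed
  then obtain q where q: "prime q" "q dvd T'" using prime_factor_nat by blast
  define r where "r = T' div q"
  have T'r: "T' = r * q" using q by (simp add: r_def)
  have r: "r > 0" "r < T'" using T'r T'(1) q prime_gt_1_nat by auto
  have "\<exists>n. s (n + r) \<noteq> s n" using le r by (meson leD)
  then have s_moved: "(\<lambda>n. s (n + r)) \<noteq> s" by metis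
  define L where "L = linear_complexity s"
  obtain c where c: "lin_rec L c s" using lin_rec_linear_complexity(1)[of T s, OF T per] L_def by auto
  \<comment> \<open>The period \<open>T'\<close> is imposed on the solutions so that
    \<open>q\<close> shifts by \<open>r\<close> give the identity on \<open>V\<close>.\<close>
  define V where "V = {t. lin_rec L c t \<and> (\<forall>n. t (n + T') = t n)}"
  define \<sigma> where "\<sigma> = (\<lambda>t :: nat \<Rightarrow> bit. \<lambda>n. t (n + r))"
  define W where "W = {t \<in> V. \<sigma> t = t}"
  have inj: "inj_on (\<lambda>t. restrict t {..<L}) V"
  proof (rule inj_onI)
    fix t u assume "t \<in> V" "u \<in> V" "restrict t {..<L} = restrict u {..<L}"
    then show "t = u" by (intro lin_rec_eqI[of L c t u]) (auto simp: V_def dest: fun_cong split: if_splits)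
  qed
  have UNIVbit: "(UNIV :: bit set) = {0, 1}" using bit_not_zero_iff by auto
  have fin: "finite (PiE {..<L} (\<lambda>_. UNIV :: bit set))"
    by (intro finite_PiE) (auto simp: UNIVbit)
  have img: "(\<lambda>t. restrict t {..<L}) ` V \<subseteq> PiE {..<L} (\<lambda>_. UNIV)"
    by (intro image_subsetI) (simp add: restrict_PiE_iff)
  have finV: "finite V" using finite_imageD[OF finite_subset[OF img fin] inj] .
  have "card V \<le> card (PiE {..<L} (\<lambda>_. UNIV :: bit set))"
    by (rule card_inj_on_le[OF inj img fin])
  also have "\<dots> = 2 ^ L" by (simp add: card_PiE UNIVbit numeral_2_eq_2)
  finally have cV: "card V \<le> 2 ^ L" .
  have zero: "(\<lambda>_. 0) \<in> W" by (auto simp: W_def V_def \<sigma>_def lin_rec_def)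
  have addV: "(\<lambda>n. a n + b n) \<in> V" if "a \<in> V" "b \<in> V" for a b
    using that lin_rec_add[of L c a b] by (auto simp: V_def)
  have addW: "(\<lambda>n. a n + b n) \<in> W" if "a \<in> W" "b \<in> W" for a b
  proof -
    have "a (n + r) = a n" "b (n + r) = b n" for n
      using that unfolding W_def \<sigma>_def by (auto simp: fun_eq_iff)
    then show ?thesis using that addV unfolding W_def \<sigma>_def by auto
  qed
  have finW: "finite W" using finV W_def by simp
  obtain k where k: "card V = 2 ^ k * card W"
  proof (rule exE[OF card_eq_power2_mult_card[OF finV _ _ addV addW]])
    show "W \<subseteq> V" "W \<noteq> {}" using zero by (auto simp: W_def)
  qed
  \<comment> \<open>With the zero space as the smaller subspace, the same counting lemma shows that
    \<open>card W\<close> is a power of 2.\<close>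
  have "(\<lambda>n. a n + b n) = (\<lambda>_. 0)" if "a \<in> {\<lambda>_. 0 :: bit}" "b \<in> {\<lambda>_. 0}" for a b :: "nat \<Rightarrow> bit"
    using that by auto
  then obtain w where w: "card W = 2 ^ w"
    using card_eq_power2_mult_card[OF finW, of "{\<lambda>_. 0}"] zero addW by fastforce
  have sV: "s \<in> V" using c T'(2) by (simp add: V_def)
  have "\<sigma> ` V \<subseteq> V"
  proof
    fix u assume "u \<in> \<sigma> ` V"
    then obtain t where t: "t \<in> V" "u = \<sigma> t" by auto
    have "t (n + T' + r) = t (n + r)" for n
    proof -
      have "t ((n + r) + T') = t (n + r)" using t(1) unfolding V_def by blast
      then show ?thesis by (simp only: ac_simps)
    qed
    then show "u \<in> V" using t lin_rec_shift[of L c t r] by (simp add: V_def \<sigma>_def)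
  qed
  moreover have "(\<sigma> ^^ i) t = (\<lambda>n. t (n + r * i))" for i t
    by (induction i) (auto simp: \<sigma>_def algebra_simps)
  then have "(\<sigma> ^^ q) x = x" if "x \<in> V" for x using that T'r by (auto simp: V_def)
  ultimately have "q dvd card {x \<in> V. \<sigma> x \<noteq> x}"
    by (intro prime_dvd_card_moved_points finV q(1))
  moreover have "{x \<in> V. \<sigma> x \<noteq> x} = V - W" by (auto simp: W_def)
  moreover have "card (V - W) = card V - card W" using finW by (intro card_Diff_subset) (auto simp: W_def)
  \<comment> \<open>This is the cardinality of \<open>V - W\<close>. The odd prime \<open>q\<close>
    must divide the second factor, and \<open>k > 0\<close> because \<open>s\<close> lies in
    \<open>V\<close> but not in \<open>W\<close>.\<close>
  ultimately have "q dvd 2 ^ w * (2 ^ k - 1)" using k w by (simp add: algebra_simps)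
  moreover have qT: "q dvd T" using q dvd dvd_trans by blast
  have "odd q" using qT assms(1) dvd_trans by blast
  then have "coprime q (2 ^ w)" by (simp add: coprime_commute)
  ultimately have "q dvd 2 ^ k - 1" by (simp add: coprime_dvd_mult_right_iff)
  then have "[2 ^ k = 1] (mod q)"
    by (simp add: cong_altdef_nat)
  then have "ord q 2 dvd k" by (simp add: ord_divides')
  moreover have "k > 0"
  proof (rule ccontr)
    assume "\<not> k > 0"
    then have "V = W" using k finV card_subset_eq[of V W] by (simp add: W_def)
    then show False using sV s_moved by (auto simp: W_def \<sigma>_def)
  qed
  ultimately have "ord q 2 \<le> k" by (simp add: dvd_imp_le)
  moreover have "2 ^ (k + w) \<le> (2::nat) ^ L" using cV k w by (simp add: power_add)
  then have "k + w \<le> L" by (simp add: power_increasing_iff)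
  \<comment> \<open>Adding the shifts of \<open>s\<close> over a full period gives the constant
    sequence 1, which is thus a solution of the recurrence; together with 0 it makes
    \<open>W\<close> at least two-dimensional as a count of elements, that is, \<open>card W\<close>
    is at least 2.\<close>
  moreover have "w > 0" if sum1: "(\<Sum>n<T. s n) = 1"
  proof -
    have sum: "(\<Sum>j<T. s (n + j)) = 1" for n
    proof (induction n)
      case 0
      then show ?case using sum1 by simp
    next
      case (Suc n)
      \<comment> \<open>Moving the window by one place trades \<open>s n\<close> for the equal value
        \<open>s (n + T)\<close>.\<close>
      have "(\<Sum>j<T. s (Suc n + j)) + s n = s n + (\<Sum>j<T. s (n + Suc j))"
        by (simp only: add_Suc add_Suc_right add.commute[of _ "s n"])
      also have "\<dots> = (\<Sum>j<Suc T. s (n + j))" by (subst sum.lessThan_Suc_shift) simp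
      also have "\<dots> = (\<Sum>j<T. s (n + j)) + s n" using per by simp
      finally show ?case using Suc by (metis add_right_imp_eq)
    qed
    have "lin_rec L c (\<lambda>n. \<Sum>j<T. s (n + j))"
      by (intro lin_rec_sum lin_rec_shift c) auto
    then have "(\<lambda>_. 1) \<in> W" unfolding sum by (simp add: W_def V_def \<sigma>_def)
    then have "{\<lambda>_. 0, \<lambda>_. 1} \<subseteq> W" using zero by simp
    moreover have "card {(\<lambda>_. 0) :: nat \<Rightarrow> bit, \<lambda>_. 1} = 2" by (simp add: fun_eq_iff)
    ultimately have "2 \<le> card W" using card_mono[OF finW] by metis
    then show ?thesis using w by (cases w) auto
  qed
  ultimately have "ord q 2 + of_bool ((\<Sum>n<T. s n) = 1) \<le> L" by auto
  moreover have "q \<in> prime_factors T" using q(1) qT T by (simp add: in_prime_factors_iff)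
  ultimately show ?thesis unfolding L_def by blast
qed

subsection \<open>Jacobi sums\<close>

lemma sum_mod_shift:
  fixes f :: "int \<Rightarrow> 'a::comm_monoid_add"
  assumes "p > 0" "\<And>x. f (x mod p) = f x"
  shows "(\<Sum>x\<in>{0..<p}. f (x + c)) = (\<Sum>x\<in>{0..<p}. f x)"
proof -
  have "bij_betw (\<lambda>x. (x + c) mod p) {0..<p} {0..<p}"
  proof (rule bij_betw_byWitness[where f' = "\<lambda>x. (x - c) mod p"])
    show "\<forall>a\<in>{0..<p}. ((a + c) mod p - c) mod p = a" "\<forall>a\<in>{0..<p}. ((a - c) mod p + c) mod p = a"
      by (simp_all add: mod_diff_left_eq mod_add_left_eq)
  qed (use assms(1) in auto)
  then have "(\<Sum>x\<in>{0..<p}. f ((x + c) mod p)) = (\<Sum>x\<in>{0..<p}. f x)"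
    by (rule sum.reindex_bij_betw)
  then show ?thesis by (simp add: assms(2))
qed

lemma sum_mod_scale:
  fixes f :: "int \<Rightarrow> 'a::comm_monoid_add"
  assumes "p > 0" "coprime c p" "\<And>x. f (x mod p) = f x"
  shows "(\<Sum>x\<in>{0..<p}. f (c * x)) = (\<Sum>x\<in>{0..<p}. f x)"
proof -
  obtain d where "[c * d = 1] (mod p)" using assms(2) cong_solve_coprime_int by blast
  then have d: "c * d mod p = 1 mod p" by (simp add: cong_def)
  have "bij_betw (\<lambda>x. c * x mod p) {0..<p} {0..<p}"
  proof (rule bij_betw_byWitness[where f' = "\<lambda>x. d * x mod p"])
    have "d * (c * a mod p) mod p = a" "c * (d * a mod p) mod p = a" if "a \<in> {0..<p}" for a
    proof -
      have "(c * d) * a mod p = a" using that d by (metis mod_mult_left_eq mult_1 mod_pos_pos_trivial atLeastLessThan_iff)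
      then show "d * (c * a mod p) mod p = a" "c * (d * a mod p) mod p = a"
        by (simp_all add: mod_mult_right_eq ac_simps)
    qed
    then show "\<forall>a\<in>{0..<p}. d * (c * a mod p) mod p = a" "\<forall>a\<in>{0..<p}. c * (d * a mod p) mod p = a"
      by auto
  qed (use assms(1) in auto)
  then have "(\<Sum>x\<in>{0..<p}. f (c * x mod p)) = (\<Sum>x\<in>{0..<p}. f x)"
    by (rule sum.reindex_bij_betw)
  then show ?thesis by (simp add: assms(3))
qed

text \<open>The norm condition says at once that the character vanishes on multiples of
  \<open>p\<close> and has absolute value 1 elsewhere. The principal character is included.\<close>

definition dirichlet_char :: "int \<Rightarrow> (int \<Rightarrow> complex) \<Rightarrow> bool" where
  "dirichlet_char p \<chi> \<longleftrightarrow> (\<forall>x y. \<chi> (x * y) = \<chi> x * \<chi> y) \<and> (\<forall>x. \<chi> (x mod p) = \<chi> x) \<and>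
     (\<forall>x. norm (\<chi> x) = of_bool (\<not> p dvd x))"

text \<open>For \<open>h = 1\<close> and characters modulo \<open>p\<close> the substitution of
  \<open>-x\<close> for \<open>x\<close> gives the classical Jacobi sum up to the factor
  \<open>\<chi> (-1)\<close>. All shifts \<open>h\<close> are needed for counting pairs at distance
  \<open>h\<close>.\<close>

definition jacobi_sum :: "int \<Rightarrow> (int \<Rightarrow> complex) \<Rightarrow> (int \<Rightarrow> complex) \<Rightarrow> int \<Rightarrow> complex" where
  "jacobi_sum p \<chi> \<psi> h = (\<Sum>x\<in>{0..<p}. \<chi> x * \<psi> (x + h))"

lemma dirichlet_char_mult_cnj: "dirichlet_char p \<chi> \<Longrightarrow> \<chi> x * cnj (\<chi> x) = of_bool (\<not> p dvd x)"
  by (auto simp: dirichlet_char_def complex_norm_square[symmetric])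

text \<open>Multiplication by \<open>a\<close> permutes the residues, so the sum equals
  \<open>\<chi> a\<close> times itself. The element \<open>a\<close> witnesses that the character is
  not principal.\<close>

lemma sum_dirichlet_char:
  assumes "prime p" "dirichlet_char p \<chi>" "\<not> p dvd a" "\<chi> a \<noteq> 1"
  shows "(\<Sum>x\<in>{0..<p}. \<chi> x) = 0"
proof -
  have "coprime a p" using assms by (metis coprime_commute prime_imp_coprime)
  then have "(\<Sum>x\<in>{0..<p}. \<chi> (a * x)) = (\<Sum>x\<in>{0..<p}. \<chi> x)"
    using assms prime_gt_0_int by (intro sum_mod_scale) (auto simp: dirichlet_char_def)
  moreover have "(\<Sum>x\<in>{0..<p}. \<chi> (a * x)) = \<chi> a * (\<Sum>x\<in>{0..<p}. \<chi> x)"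
    using assms by (simp add: dirichlet_char_def sum_distrib_left)
  ultimately show ?thesis using assms(4) by (metis mult_cancel_right1)
qed

lemma sum_of_bool_not_dvd:
  assumes "(p::int) > 0"
  shows "(\<Sum>x\<in>{0..<p}. of_bool (\<not> p dvd x)) = (of_int p - 1 :: complex)"
proof -
  have "(\<Sum>x\<in>{0..<p}. of_bool (\<not> p dvd x)) = (\<Sum>x\<in>{0<..<p}. 1 :: complex)"
    using assms by (intro sum.mono_neutral_cong_right) (auto dest: zdvd_imp_le)
  then show ?thesis using assms by (simp add: of_nat_diff)
qed

text \<open>By scaling, the autocorrelation takes the same value at every nonzero \<open>t\<close>,
  and at 0 it is \<open>p - 1\<close>. Its sum over all \<open>t\<close> contains the full character
  sum as a factor and vanishes, which forces the common value -1.\<close>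

lemma sum_dirichlet_char_cnj_shift:
  assumes "prime p" "dirichlet_char p \<psi>" "\<not> p dvd a" "\<psi> a \<noteq> 1"
  shows "(\<Sum>h\<in>{0..<p}. \<psi> h * cnj (\<psi> (h + t))) = of_bool (p dvd t) * of_int p - 1"
proof -
  have p: "p > 0" using assms prime_gt_0_int by blast
  have per: "\<psi> (x mod p) = \<psi> x" and mul: "\<psi> (x * y) = \<psi> x * \<psi> y" for x y
    using assms(2) by (auto simp: dirichlet_char_def)
  define C where "C t = (\<Sum>h\<in>{0..<p}. \<psi> h * cnj (\<psi> (h + t)))" for t
  have per2: "\<psi> (x mod p + t) = \<psi> (x + t)" for x t by (metis mod_add_left_eq per)
  have C_dvd: "C t = of_int p - 1" if "p dvd t" for t
  proof -
    have "\<psi> (h + t) = \<psi> h" for h using that per[of "h + t"] per[of h] by (auto elim!: dvdE)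
    then have "C t = (\<Sum>x\<in>{0..<p}. of_bool (\<not> p dvd x))"
      unfolding C_def by (simp add: dirichlet_char_mult_cnj[OF assms(2)])
    then show ?thesis using sum_of_bool_not_dvd[OF p] by simp
  qed
  have C_ndvd: "C t = C 1" if t: "\<not> p dvd t" for t
  proof -
    have cop: "coprime t p" using assms t by (metis coprime_commute prime_imp_coprime)
    have "C t = (\<Sum>h\<in>{0..<p}. \<psi> (t * h) * cnj (\<psi> (t * h + t)))"
      unfolding C_def using p cop by (intro sum_mod_scale[symmetric]) (auto simp: per per2)
    also have "\<dots> = (\<Sum>h\<in>{0..<p}. (\<psi> t * cnj (\<psi> t)) * (\<psi> h * cnj (\<psi> (h + 1))))"
    proof (intro sum.cong refl)
      fix h
      have "\<psi> (t * h + t) = \<psi> t * \<psi> (h + 1)" using mul[of t "h + 1"] by (simp add: algebra_simps)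
      then show "\<psi> (t * h) * cnj (\<psi> (t * h + t)) = (\<psi> t * cnj (\<psi> t)) * (\<psi> h * cnj (\<psi> (h + 1)))"
        by (simp add: mul)
    qed
    also have "\<dots> = C 1" using t unfolding dirichlet_char_mult_cnj[OF assms(2)] C_def by simp
    finally show ?thesis .
  qed
  have p1: "of_int p - 1 \<noteq> (0::complex)" using assms(1) prime_gt_1_int[of p]
    by (metis eq_iff_diff_eq_0 less_irrefl of_int_1 of_int_eq_iff)
  have "(\<Sum>t\<in>{0..<p}. C t) = (\<Sum>h\<in>{0..<p}. \<psi> h * (\<Sum>t\<in>{0..<p}. cnj (\<psi> (t + h))))"
    unfolding C_def by (subst sum.swap) (simp add: sum_distrib_left add.commute)
  also have "\<dots> = (\<Sum>h\<in>{0..<p}. \<psi> h * (\<Sum>t\<in>{0..<p}. cnj (\<psi> t)))"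
    using p per by (intro sum.cong refl arg_cong2[of _ _ _ _ "(*)"] sum_mod_shift) auto
  also have "\<dots> = 0" using sum_dirichlet_char[OF assms] by (simp flip: sum_distrib_right)
  finally have "0 = (\<Sum>t\<in>{0..<p}. C t)" by simp
  also have "\<dots> = C 0 + (\<Sum>t\<in>{0..<p} - {0}. C t)" using p by (subst sum.remove[of _ 0]) auto
  also have "(\<Sum>t\<in>{0..<p} - {0}. C t) = (\<Sum>t\<in>{0..<p} - {0}. C 1)"
    by (intro sum.cong refl C_ndvd) (auto dest: zdvd_imp_le)
  also have "\<dots> = (of_int p - 1) * C 1" using p by (simp add: of_nat_diff)
  finally have "0 = C 0 + (of_int p - 1) * C 1" .
  also have "\<dots> = (of_int p - 1) * (1 + C 1)"
    by (simp add: C_dvd algebra_simps)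
  finally have "(of_int p - 1) * (1 + C 1) = 0" by simp
  then have "C 1 = -1" using p1 by (metis add.commute add_eq_0_iff mult_eq_0_iff)
  then have "C t = of_bool (p dvd t) * of_int p - 1" using C_dvd[of t] C_ndvd[of t] by auto
  then show ?thesis by (simp add: C_def)
qed

text \<open>Replacing \<open>x\<close> by \<open>h * x\<close> pulls out the factor
  \<open>\<chi> h * \<psi> h\<close>, which has absolute value 1.\<close>

lemma norm_jacobi_sum_scale:
  assumes "prime p" "dirichlet_char p \<chi>" "dirichlet_char p \<psi>" "\<not> p dvd h"
  shows "norm (jacobi_sum p \<chi> \<psi> h) = norm (jacobi_sum p \<chi> \<psi> 1)"
proof -
  have p: "p > 0" using assms prime_gt_0_int by blast
  have per: "\<psi> (x mod p) = \<psi> x" "\<chi> (x mod p) = \<chi> x"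
    and mul: "\<psi> (x * y) = \<psi> x * \<psi> y" "\<chi> (x * y) = \<chi> x * \<chi> y" for x y
    using assms(2,3) by (auto simp: dirichlet_char_def)
  have per2: "\<psi> (x mod p + t) = \<psi> (x + t)" for x t by (metis mod_add_left_eq per(1))
  have cop: "coprime h p" using assms by (metis coprime_commute prime_imp_coprime)
  have "jacobi_sum p \<chi> \<psi> h = (\<Sum>x\<in>{0..<p}. \<chi> (h * x) * \<psi> (h * x + h))"
    unfolding jacobi_sum_def using p cop by (intro sum_mod_scale[symmetric]) (auto simp: per per2)
  also have "\<dots> = (\<Sum>x\<in>{0..<p}. (\<chi> h * \<psi> h) * (\<chi> x * \<psi> (x + 1)))"
  proof (intro sum.cong refl)
    fix x
    have "\<psi> (h * x + h) = \<psi> h * \<psi> (x + 1)" using mul(1)[of h "x + 1"] by (simp add: algebra_simps)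
    then show "\<chi> (h * x) * \<psi> (h * x + h) = (\<chi> h * \<psi> h) * (\<chi> x * \<psi> (x + 1))"
      by (simp add: mul)
  qed
  also have "\<dots> = (\<chi> h * \<psi> h) * jacobi_sum p \<chi> \<psi> 1"
    by (simp add: jacobi_sum_def sum_distrib_left)
  finally show ?thesis using assms by (simp add: norm_mult dirichlet_char_def)
qed

text \<open>The sum of \<open>\<bar>J(h)\<bar>\<^sup>2\<close> over all residues \<open>h\<close> is computed exactly by orthogonality, and
  all \<open>p - 1\<close> terms with \<open>h \<noteq> 0\<close> are equal.\<close>

lemma norm_jacobi_sum_le:
  assumes "prime p" "dirichlet_char p \<chi>" "dirichlet_char p \<psi>" "\<not> p dvd a" "\<psi> a \<noteq> 1" "\<not> p dvd h"
  shows "norm (jacobi_sum p \<chi> \<psi> h) \<le> sqrt (of_int p)"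
proof -
  have p: "p > 0" "p > 1" using assms prime_gt_1_int[of p] by auto
  have per: "\<psi> (x mod p) = \<psi> x" "\<chi> (x mod p) = \<chi> x" for x
    using assms(2,3) by (auto simp: dirichlet_char_def)
  have per2: "\<psi> (x mod p + t) = \<psi> (x + t)" for x t by (metis mod_add_left_eq per(1))
  define J where "J = jacobi_sum p \<chi> \<psi>"
  define S where "S = (\<Sum>x\<in>{0..<p}. \<chi> x)"
  let ?R = "{0..<p}"
  \<comment> \<open>After expansion the sum over \<open>h\<close> is taken first; it is the
    autocorrelation of \<open>\<psi>\<close> at \<open>y - x\<close>.\<close>
  have "(\<Sum>h\<in>?R. J h * cnj (J h)) = (\<Sum>h\<in>?R. \<Sum>x\<in>?R. \<Sum>y\<in>?R.
      \<chi> x * cnj (\<chi> y) * (\<psi> (x + h) * cnj (\<psi> (y + h))))"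
    unfolding J_def jacobi_sum_def by (simp add: sum_product cnj_sum ac_simps)
  also have "\<dots> = (\<Sum>x\<in>?R. \<Sum>h\<in>?R. \<Sum>y\<in>?R.
      \<chi> x * cnj (\<chi> y) * (\<psi> (x + h) * cnj (\<psi> (y + h))))" by (rule sum.swap)
  also have "\<dots> = (\<Sum>x\<in>?R. \<Sum>y\<in>?R. \<chi> x * cnj (\<chi> y) *
      (\<Sum>h\<in>?R. \<psi> (h + x) * cnj (\<psi> ((h + x) + (y - x)))))"
    by (subst sum.swap) (simp add: sum_distrib_left add.commute)
  also have "\<dots> = (\<Sum>x\<in>?R. \<Sum>y\<in>?R. \<chi> x * cnj (\<chi> y) *
      (\<Sum>h\<in>?R. \<psi> h * cnj (\<psi> (h + (y - x)))))"
  proof -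
    have "(\<Sum>h\<in>?R. \<psi> (h + x) * cnj (\<psi> ((h + x) + (y - x)))) = (\<Sum>h\<in>?R. \<psi> h * cnj (\<psi> (h + (y - x))))" for x y
      using p(1) by (rule sum_mod_shift[where f = "\<lambda>h. \<psi> h * cnj (\<psi> (h + (y - x)))"]) (simp only: per per2)
    then show ?thesis by (simp only:)
  qed
  also have "\<dots> = (\<Sum>x\<in>?R. \<Sum>y\<in>?R. \<chi> x * cnj (\<chi> y) * (of_bool (p dvd y - x) * of_int p - 1))"
    by (simp only: sum_dirichlet_char_cnj_shift[OF assms(1,3,4,5)])
  \<comment> \<open>Since \<open>\<chi>\<close> may be principal, \<open>S\<close> may be nonzero;
    its contribution is negative, which is harmless for an upper bound.\<close>
  also have "\<dots> = (\<Sum>x\<in>?R. (\<Sum>y\<in>?R. \<chi> x * cnj (\<chi> y) * (of_bool (p dvd y - x) * of_int p))) - S * cnj S"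
    by (simp add: S_def right_diff_distrib sum_subtractf sum_product cnj_sum)
  also have "(\<Sum>x\<in>?R. \<Sum>y\<in>?R. \<chi> x * cnj (\<chi> y) * (of_bool (p dvd y - x) * of_int p)) =
      (\<Sum>x\<in>?R. of_bool (\<not> p dvd x) * of_int p)"
  proof (intro sum.cong refl)
    fix x assume x: "x \<in> ?R"
    have "(\<Sum>y\<in>?R. \<chi> x * cnj (\<chi> y) * (of_bool (p dvd y - x) * of_int p)) =
        (\<Sum>y\<in>{x}. \<chi> x * cnj (\<chi> y) * of_int p)"
    proof (intro sum.mono_neutral_cong_right)
      have "y = x" if "p dvd y - x" "y \<in> ?R" for y
        using that x by (metis atLeastLessThan_iff mod_eq_dvd_iff mod_pos_pos_trivial)
      then show "\<forall>i\<in>?R - {x}. \<chi> x * cnj (\<chi> i) * (of_bool (p dvd i - x) * of_int p) = 0" by auto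
    qed (use x in auto)
    then show "(\<Sum>y\<in>?R. \<chi> x * cnj (\<chi> y) * (of_bool (p dvd y - x) * of_int p)) =
        of_bool (\<not> p dvd x) * of_int p"
      by (simp add: dirichlet_char_mult_cnj[OF assms(2)])
  qed
  also have "\<dots> = (of_int p - 1) * of_int p"
    by (simp only: sum_of_bool_not_dvd[OF p(1)] flip: sum_distrib_right)
  finally have "complex_of_real (\<Sum>h\<in>?R. (norm (J h))\<^sup>2) =
      complex_of_real ((of_int p - 1) * of_int p - (norm S)\<^sup>2)"
    by (simp add: complex_norm_square del: of_real_power)
  then have sumJ: "(\<Sum>h\<in>?R. (norm (J h))\<^sup>2) = (of_int p - 1) * of_int p - (norm S)\<^sup>2"
    by (simp only: of_real_eq_iff)
  have "(of_int p - 1) * (norm (J h))\<^sup>2 = (\<Sum>k\<in>?R - {0}. (norm (J h))\<^sup>2)"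
    using p by (simp add: of_nat_diff)
  also have "\<dots> = (\<Sum>k\<in>?R - {0}. (norm (J k))\<^sup>2)"
  proof (intro sum.cong refl)
    fix k assume "k \<in> ?R - {0}"
    then have "\<not> p dvd k" by (auto dest: zdvd_imp_le)
    then show "(norm (J h))\<^sup>2 = (norm (J k))\<^sup>2"
      unfolding J_def using norm_jacobi_sum_scale[OF assms(1-3)] assms(6) by simp
  qed
  also have "\<dots> \<le> (\<Sum>k\<in>?R. (norm (J k))\<^sup>2)" by (intro sum_mono2) auto
  also have "\<dots> \<le> (of_int p - 1) * of_int p" using sumJ by simp
  finally have "(norm (J h))\<^sup>2 \<le> of_int p"
    using p by (simp add: mult_le_cancel_left)
  then show ?thesis unfolding J_def by (rule real_le_rsqrt)
qed

text \<open>This makes the square root bound, which asks the second character to be nonprincipal,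
  available when only the first one is.\<close>

lemma jacobi_sum_commute:
  assumes "p > 0" "dirichlet_char p \<chi>" "dirichlet_char p \<psi>"
  shows "jacobi_sum p \<chi> \<psi> h = jacobi_sum p \<psi> \<chi> (- h)"
proof -
  have per: "\<psi> (x mod p) = \<psi> x" "\<chi> (x mod p) = \<chi> x" for x
    using assms(2,3) by (auto simp: dirichlet_char_def)
  have per2: "\<chi> (x mod p + t) = \<chi> (x + t)" for x t by (metis mod_add_left_eq per(2))
  have "(\<Sum>x\<in>{0..<p}. \<psi> (x + h) * \<chi> ((x + h) + (- h))) = (\<Sum>x\<in>{0..<p}. \<psi> x * \<chi> (x + (- h)))"
    using assms(1) by (rule sum_mod_shift) (simp only: per per2)
  then show ?thesis by (simp add: jacobi_sum_def mult.commute)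
qed

text \<open>Every summand is 1 except at the two distinct residues 0 and \<open>-h\<close>, where
  one of the factors vanishes.\<close>

lemma jacobi_sum_principal:
  assumes "prime p" "\<not> p dvd h" "\<And>x. \<not> p dvd x \<Longrightarrow> \<chi> x = 1" "\<And>x. \<not> p dvd x \<Longrightarrow> \<psi> x = 1"
    "dirichlet_char p \<chi>" "dirichlet_char p \<psi>"
  shows "jacobi_sum p \<chi> \<psi> h = of_int p - 2"
proof -
  have p: "p > 1" using assms prime_gt_1_int by blast
  define b where "b = (- h) mod p"
  have b: "b \<in> {0..<p}" "b \<noteq> 0" using p assms(2) by (auto simp: b_def mod_eq_0_iff_dvd)
  have "jacobi_sum p \<chi> \<psi> h = (\<Sum>x\<in>{0..<p} - {0, b}. 1)"
    unfolding jacobi_sum_def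
  proof (intro sum.mono_neutral_cong_right ballI)
    have nz: "\<chi> x = 0 \<longleftrightarrow> p dvd x" "\<psi> x = 0 \<longleftrightarrow> p dvd x" for x
      using assms(5,6) unfolding dirichlet_char_def by (metis norm_eq_zero of_bool_eq_0_iff)+
    have dvd_b: "p dvd x + h \<longleftrightarrow> x = b" if "x \<in> {0..<p}" for x
      using that unfolding b_def
      by (metis add_uminus_conv_diff atLeastLessThan_iff diff_minus_eq_add mod_eq_dvd_iff mod_mod_trivial mod_pos_pos_trivial)
    show "\<chi> x * \<psi> (x + h) = 0" if "x \<in> {0..<p} - ({0..<p} - {0, b})" for x
      using that nz dvd_b by auto
    show "\<chi> x * \<psi> (x + h) = 1" if "x \<in> {0..<p} - {0, b}" for x
    proof -
      have "\<not> p dvd x" using that by (auto dest: zdvd_imp_le)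
      then show ?thesis using that dvd_b[of x] assms(3)[of x] assms(4)[of "x + h"] by auto
    qed
  qed auto
  also have "\<dots> = of_int p - 2"
    using b p Suc_leI[of "Suc 0" "nat p"] by (simp add: card_Diff_subset of_nat_diff)
  finally show ?thesis .
qed

text \<open>The product is expanded into Jacobi sums. Pairs of principal characters give the main
  term exactly, every other pair costs at most \<open>sqrt p\<close> times its weights. The set
  \<open>I0\<close> marks the indices of the principal character, which may occur
  repeatedly.\<close>

lemma autocorrelation_bound:
  fixes \<chi> :: "'i \<Rightarrow> int \<Rightarrow> complex" and w :: "'i \<Rightarrow> complex"
  assumes "prime p" "\<not> p dvd h" "finite I" "\<And>i. i \<in> I \<Longrightarrow> dirichlet_char p (\<chi> i)"
    and f: "\<And>x. f x = (\<Sum>i\<in>I. w i * \<chi> i x)"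
    and triv: "\<And>i x. i \<in> I \<Longrightarrow> i \<in> I0 \<Longrightarrow> \<not> p dvd x \<Longrightarrow> \<chi> i x = 1"
    and nontriv: "\<And>i. i \<in> I \<Longrightarrow> i \<notin> I0 \<Longrightarrow> \<exists>a. \<not> p dvd a \<and> \<chi> i a \<noteq> 1"
  shows "norm ((\<Sum>x\<in>{0..<p}. f x * f (x + h)) - (\<Sum>i\<in>I \<inter> I0. w i)\<^sup>2 * (of_int p - 2))
    \<le> (\<Sum>i\<in>I. norm (w i))\<^sup>2 * sqrt (of_int p)"
proof -
  have p: "p > 0" using assms prime_gt_0_int by blast
  have "(\<Sum>i\<in>I \<inter> I0. w i) = (\<Sum>i\<in>I. w i * of_bool (i \<in> I0))"
    using assms(3) by (intro sum.mono_neutral_cong_left) auto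
  then have "(\<Sum>i\<in>I \<inter> I0. w i)\<^sup>2 * (of_int p - 2) =
      (\<Sum>i\<in>I. \<Sum>j\<in>I. w i * w j * (of_bool (i \<in> I0 \<and> j \<in> I0) * (of_int p - 2)))"
    by (simp add: power2_eq_square sum_product sum_distrib_left sum_distrib_right of_bool_conj ac_simps)
  moreover have "(\<Sum>x\<in>{0..<p}. f x * f (x + h)) = (\<Sum>i\<in>I. \<Sum>j\<in>I. w i * w j * jacobi_sum p (\<chi> i) (\<chi> j) h)"
  proof -
    have "(\<Sum>x\<in>{0..<p}. f x * f (x + h)) = (\<Sum>x\<in>{0..<p}. \<Sum>i\<in>I. \<Sum>j\<in>I. w i * w j * (\<chi> i x * \<chi> j (x + h)))"
      by (simp add: f sum_product ac_simps)
    also have "\<dots> = (\<Sum>i\<in>I. \<Sum>x\<in>{0..<p}. \<Sum>j\<in>I. w i * w j * (\<chi> i x * \<chi> j (x + h)))"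
      by (rule sum.swap)
    also have "\<dots> = (\<Sum>i\<in>I. \<Sum>j\<in>I. \<Sum>x\<in>{0..<p}. w i * w j * (\<chi> i x * \<chi> j (x + h)))"
      by (intro sum.cong refl sum.swap)
    finally show ?thesis by (simp add: jacobi_sum_def sum_distrib_left)
  qed
  ultimately have "(\<Sum>x\<in>{0..<p}. f x * f (x + h)) - (\<Sum>i\<in>I \<inter> I0. w i)\<^sup>2 * (of_int p - 2) =
     (\<Sum>i\<in>I. \<Sum>j\<in>I. w i * w j * (jacobi_sum p (\<chi> i) (\<chi> j) h - of_bool (i \<in> I0 \<and> j \<in> I0) * (of_int p - 2)))"
    by (simp add: sum_subtractf right_diff_distrib)
  also have "norm \<dots> \<le> (\<Sum>i\<in>I. \<Sum>j\<in>I. norm (w i) * norm (w j) * sqrt (of_int p))"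
  proof (intro sum_norm_le)
    fix i j assume i: "i \<in> I" and j: "j \<in> I"
    have "norm (jacobi_sum p (\<chi> i) (\<chi> j) h - of_bool (i \<in> I0 \<and> j \<in> I0) * (of_int p - 2)) \<le> sqrt (of_int p)"
    proof (cases "i \<in> I0 \<and> j \<in> I0")
      case True
      then have "jacobi_sum p (\<chi> i) (\<chi> j) h = of_int p - 2"
        using assms i j by (intro jacobi_sum_principal) auto
      then show ?thesis using True p by simp
    next
      case False
      have "norm (jacobi_sum p (\<chi> i) (\<chi> j) h) \<le> sqrt (of_int p)"
      \<comment> \<open>If the second character is principal then the first is not, and the two are
        exchanged.\<close>
      proof (cases "j \<in> I0")
        case True
        then obtain a where "\<not> p dvd a" "\<chi> i a \<noteq> 1" using False i nontriv by blast
        then show ?thesis using jacobi_sum_commute[OF p, of "\<chi> i" "\<chi> j" h] assms i j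
          norm_jacobi_sum_le[of p "\<chi> j" "\<chi> i" a "- h"] by simp
      next
        case False
        then obtain a where "\<not> p dvd a" "\<chi> j a \<noteq> 1" using j nontriv by blast
        then show ?thesis using assms i j by (intro norm_jacobi_sum_le) auto
      qed
      then show ?thesis using False by auto
    qed
    then show "norm (w i * w j * (jacobi_sum p (\<chi> i) (\<chi> j) h - of_bool (i \<in> I0 \<and> j \<in> I0) * (of_int p - 2)))
       \<le> norm (w i) * norm (w j) * sqrt (of_int p)"
      by (simp add: norm_mult mult_left_mono)
  qed
  also have "\<dots> = (\<Sum>i\<in>I. \<Sum>j\<in>I. norm (w i) * norm (w j)) * sqrt (of_int p)"
    by (simp only: sum_distrib_right)
  also have "(\<Sum>i\<in>I. \<Sum>j\<in>I. norm (w i) * norm (w j)) = (\<Sum>i\<in>I. norm (w i))\<^sup>2"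
    by (simp only: power2_eq_square sum_product)
  finally show ?thesis .
qed

subsection \<open>Counting pairs of primitive roots\<close>

lemma cis_mod_nat:
  assumes "[a = b] (mod d)" "d > 0"
  shows "cis (2 * pi * real j * real a / real d) = cis (2 * pi * real j * real b / real d)"
proof -
  have "cis (2 * pi * real j * real a / real d) = cis (2 * pi * real j * real (a mod d) / real d)" for a
  proof -
    have "real a = real d * real (a div d) + real (a mod d)"
      by (metis mult_div_mod_eq of_nat_add of_nat_mult)
    then have "2 * pi * real j * real a / real d =
        2 * pi * (real j * real (a div d)) + 2 * pi * real j * real (a mod d) / real d"
      using assms(2) by (simp add: field_simps)
    then show ?thesis by (simp add: cis_multiple_2pi flip: cis_mult of_nat_mult)
  qed
  then show ?thesis using assms(1) unfolding cong_def by metis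
qed

lemma cis_eq_1_iff_dvd:
  assumes "d > 0"
  shows "cis (2 * pi * real a / real d) = 1 \<longleftrightarrow> d dvd a"
proof
  assume "d dvd a"
  then obtain k where "a = d * k" by blast
  then have "2 * pi * real a / real d = 2 * pi * real k" using assms by simp
  then show "cis (2 * pi * real a / real d) = 1" by (simp add: cis_multiple_2pi)
next
  assume "cis (2 * pi * real a / real d) = 1"
  then have "cos (2 * pi * real a / real d) = 1" by (simp add: complex_eq_iff)
  then obtain k :: int where "2 * pi * real a / real d = of_int k * 2 * pi"
    using cos_one_2pi_int by blast
  then have "real a = of_int k * real d" using assms by (simp add: field_simps)
  then have "of_int (int a) = (of_int (k * int d) :: real)" by simp
  then have "int a = k * int d" by (simp only: of_int_eq_iff)
  then show "d dvd a" by (metis dvd_triv_right int_dvd_int_iff)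
qed

text \<open>A geometric sum over the powers of a \<open>d\<close>-th root of unity, which equals 1
  exactly if \<open>d\<close> divides \<open>a\<close>.\<close>

lemma sum_cis_eq_of_bool_dvd:
  assumes "d > 0"
  shows "(\<Sum>j<d. cis (2 * pi * real j * real a / real d)) = of_nat d * of_bool (d dvd a)"
proof -
  define z where "z = cis (2 * pi * real a / real d)"
  have "cis (2 * pi * real j * real a / real d) = z ^ j" for j
    by (simp add: z_def DeMoivre ac_simps)
  moreover have "z ^ d = 1"
    using cis_multiple_2pi[of "real a"] assms by (simp add: z_def DeMoivre)
  ultimately show ?thesis
    using cis_eq_1_iff_dvd[OF assms, of a] geometric_sum[of z d] unfolding z_def[symmetric]
    by (cases "z = 1") auto
qed

text \<open>Inclusion and exclusion, by expanding the product of
  \<open>1 - of_bool (q dvd i)\<close>. A set \<open>S\<close> of primes encodes the squarefree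
  divisor \<open>\<Prod>S\<close>, and the sign is its Moebius value.\<close>

lemma of_bool_coprime_eq_sum:
  fixes n :: nat
  assumes "n > 0"
  shows "of_bool (coprime i n) =
    (\<Sum>S\<in>Pow (prime_factors n). (-1) ^ card S * of_bool (\<Prod>S dvd i) :: 'a :: comm_ring_1)"
proof -
  have eq: "\<Prod>S dvd i \<longleftrightarrow> (\<forall>q\<in>S. q dvd i)" if "S \<subseteq> prime_factors n" for S
  proof -
    have "finite S" using that finite_subset by blast
    then show ?thesis using that
    proof (induction S rule: finite_induct)
      case (insert q S)
      have "coprime q (\<Prod>S)"
        using insert by (intro prod_coprime_right primes_coprime) (auto simp: in_prime_factors_iff)
      then have "q * \<Prod>S dvd i \<longleftrightarrow> q dvd i \<and> \<Prod>S dvd i"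
        by (meson divides_mult dvd_mult_left dvd_mult_right)
      then show ?case using insert by simp
    qed auto
  qed
  have pb: "(\<Prod>q\<in>S. of_bool (P q)) = (of_bool (\<forall>q\<in>S. P q) :: 'a)" if "finite S" for S :: "nat set" and P
    using that by (induction S rule: finite_induct) auto
  have "coprime i n \<longleftrightarrow> (\<forall>q\<in>prime_factors n. \<not> q dvd i)"
  proof
    assume "coprime i n"
    then show "\<forall>q\<in>prime_factors n. \<not> q dvd i"
      by (meson coprime_common_divisor in_prime_factors_iff not_prime_unit)
  next
    assume "\<forall>q\<in>prime_factors n. \<not> q dvd i"
    then have none: "\<not> (prime q \<and> q dvd gcd i n)" for q
      using assms by (auto simp: in_prime_factors_iff)
    show "coprime i n"
    proof (rule ccontr)
      assume "\<not> coprime i n"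
      then obtain q where "prime q" "q dvd gcd i n"
        by (metis coprime_iff_gcd_eq_1 prime_factor_nat)
      then show False using none by blast
    qed
  qed
  then have "of_bool (coprime i n) = (\<Prod>q\<in>prime_factors n. of_bool (\<not> q dvd i) :: 'a)"
    by (simp only: pb[OF finite_set_mset])
  also have "\<dots> = (\<Prod>q\<in>prime_factors n. 1 - of_bool (q dvd i))"
    by (intro prod.cong) auto
  also have "\<dots> = (\<Sum>S\<in>Pow (prime_factors n). (-1) ^ card S * (\<Prod>q\<in>S. of_bool (q dvd i)) *
      (\<Prod>q\<in>prime_factors n - S. 1))" by (rule prod_diff_conv_sum) simp
  also have "\<dots> = (\<Sum>S\<in>Pow (prime_factors n). (-1) ^ card S * of_bool (\<Prod>S dvd i))"
    using eq pb finite_subset[of _ "prime_factors n"] by (intro sum.cong) auto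
  finally show ?thesis .
qed

section \<open>Characters defined by discrete logarithms\<close>

text \<open>Integer arguments, reduced modulo \<open>p\<close>, make the indicator periodic and
  allow negative shifts.\<close>

definition primroot_indicator :: "nat \<Rightarrow> int \<Rightarrow> real" where
  "primroot_indicator p x = of_bool (residue_primroot p (nat (x mod int p)))"

text \<open>An arbitrary admissible exponent; for a primitive root \<open>g\<close> and
  \<open>x\<close> prime to \<open>p\<close> it is determined only modulo
  \<open>p - 1\<close>.\<close>

definition discrete_log :: "nat \<Rightarrow> nat \<Rightarrow> int \<Rightarrow> nat" where
  "discrete_log p g x = (SOME i. [int g ^ i = x] (mod int p))"

text \<open>For a primitive root \<open>g\<close> and \<open>d\<close> dividing
  \<open>p - 1\<close>, this is the \<open>j\<close>-th power of the character of order
  \<open>d\<close> that maps \<open>g\<close> to \<open>cis (2 * pi / d)\<close>.\<close>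

definition log_char :: "nat \<Rightarrow> nat \<Rightarrow> nat \<Rightarrow> nat \<Rightarrow> int \<Rightarrow> complex" where
  "log_char p g d j x =
     (if int p dvd x then 0 else cis (2 * pi * real j * real (discrete_log p g x) / real d))"

lemma discrete_log:
  assumes "prime p" "residue_primroot p g" "\<not> int p dvd x"
  shows "[int g ^ discrete_log p g x = x] (mod int p)"
proof -
  have p: "p > 1" using assms prime_gt_1_nat by blast
  have "nat (x mod int p) \<in> totatives p"
  proof -
    have "x mod int p \<noteq> 0" "0 \<le> x mod int p" "x mod int p < int p"
      using assms(3) p by (simp_all add: dvd_eq_mod_eq_0)
    then show ?thesis using assms(1) by (auto simp: totatives_prime)
  qed
  then have "nat (x mod int p) \<in> (\<lambda>i. g ^ i mod p) ` {..<totient p}"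
    using residue_primroot_is_generator[OF p assms(2)] by (simp only: bij_betw_def)
  then obtain i where "nat (x mod int p) = g ^ i mod p" by (rule imageE)
  then have "int (g ^ i mod p) = x mod int p" using p by (metis int_nat_eq of_nat_0_less_iff pos_mod_sign
    prime_gt_0_nat assms(1))
  then have "[int g ^ i = x] (mod int p)" by (simp add: cong_def of_nat_mod)
  then show ?thesis unfolding discrete_log_def by (rule someI)
qed

lemma discrete_log_unique:
  assumes "prime p" "residue_primroot p g" "[int g ^ i = x] (mod int p)"
  shows "[i = discrete_log p g x] (mod p - 1)"
proof -
  have cop: "coprime p g" and ord: "ord p g = p - 1"
    using assms by (auto simp: residue_primroot_def totient_prime)
  have "\<not> int p dvd x"
  proof
    assume "int p dvd x"
    then have "int p dvd int g ^ i" using assms(3) cong_dvd_iff cong_sym by blast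
    then have "p dvd g ^ i" by (metis int_dvd_int_iff of_nat_power)
    then have "p dvd g" using assms(1) prime_dvd_power by blast
    then show False using cop assms(1) by (metis coprime_common_divisor dvd_refl not_prime_unit)
  qed
  from discrete_log[OF assms(1,2) this] assms(3)
  have "[int (g ^ i) = int (g ^ discrete_log p g x)] (mod int p)"
    using cong_sym cong_trans by (metis of_nat_power)
  then have "[g ^ i = g ^ discrete_log p g x] (mod p)" by (simp only: cong_int_iff)
  then show ?thesis using order_divides_expdiff[OF cop] ord by simp
qed

text \<open>The discrete logarithm is additive modulo \<open>p - 1\<close>, hence modulo its divisor
  \<open>d\<close>.\<close>

lemma dirichlet_char_log_char:
  assumes "prime p" "residue_primroot p g" "d dvd p - 1" "d > 0"
  shows "dirichlet_char (int p) (log_char p g d j)"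
proof -
  have prm: "prime (int p)" using assms(1) by simp
  have "log_char p g d j (x * y) = log_char p g d j x * log_char p g d j y" for x y
  proof (cases "int p dvd x \<or> int p dvd y")
    case False
    then have xy: "\<not> int p dvd x * y" using prm prime_dvd_mult_iff by blast
    let ?l = "discrete_log p g"
    have "[int g ^ ?l x * int g ^ ?l y = x * y] (mod int p)"
      using discrete_log[OF assms(1,2)] False by (intro cong_mult) auto
    then have "[?l x + ?l y = ?l (x * y)] (mod p - 1)"
      using discrete_log_unique[OF assms(1,2)] by (simp add: power_add)
    then have "[?l x + ?l y = ?l (x * y)] (mod d)" using assms(3) cong_dvd_modulus_nat by blast
    from cis_mod_nat[OF this assms(4), of j]
    have "cis (2 * pi * real j * real (?l (x * y)) / real d) =
      cis (2 * pi * real j * real (?l x) / real d + 2 * pi * real j * real (?l y) / real d)"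
      by (simp add: distrib_left add_divide_distrib)
    then show ?thesis using False xy by (simp add: log_char_def cis_mult)
  qed (auto simp: log_char_def)
  moreover have "discrete_log p g (x mod int p) = discrete_log p g x" for x
    by (simp add: discrete_log_def cong_def)
  then have "log_char p g d j (x mod int p) = log_char p g d j x" for x
    by (simp add: log_char_def dvd_mod_iff)
  ultimately show ?thesis by (simp add: dirichlet_char_def log_char_def)
qed

text \<open>The \<open>i\<close>-th power of a primitive root has order
  \<open>(p - 1) div gcd i (p - 1)\<close>.\<close>

lemma primroot_indicator_eq_coprime:
  assumes "prime p" "residue_primroot p g" "\<not> int p dvd x"
  shows "primroot_indicator p x = of_bool (coprime (discrete_log p g x) (p - 1))"
proof -
  let ?i = "discrete_log p g x"
  have p: "p > 1" using assms prime_gt_1_nat by blast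
  have cop: "coprime p g" and ord: "ord p g = p - 1"
    using assms by (auto simp: residue_primroot_def totient_prime)
  have "int (g ^ ?i mod p) = x mod int p"
    using discrete_log[OF assms] by (simp add: cong_def of_nat_mod)
  then have "nat (x mod int p) = g ^ ?i mod p" by simp
  then have "residue_primroot p (nat (x mod int p)) \<longleftrightarrow> residue_primroot p (g ^ ?i)" by simp
  also have "\<dots> \<longleftrightarrow> (p - 1) div gcd ?i (p - 1) = p - 1"
    using p cop ord assms(1) by (simp add: residue_primroot_def ord_power totient_prime)
  also have "\<dots> \<longleftrightarrow> coprime ?i (p - 1)"
    using p by (simp only: coprime_iff_gcd_eq_1 div_eq_dividend_iff zero_less_diff)
  finally show ?thesis by (simp add: primroot_indicator_def)
qed

text \<open>Inclusion and exclusion followed by detection of divisibility writes the indicator as a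
  combination of characters. The principal ones have total weight
  \<open>totient (p - 1) / (p - 1)\<close>, and the squared sum of the absolute weights is the power
  of 4.\<close>

theorem primroot_pair_count:
  assumes "prime p" "p > 2" "\<not> int p dvd h"
  shows "\<bar>(\<Sum>x\<in>{0..<int p}. primroot_indicator p x * primroot_indicator p (x + h)) -
      (real (totient (p - 1)) / real (p - 1))\<^sup>2 * (real p - 2)\<bar>
    \<le> 4 ^ card (prime_factors (p - 1)) * sqrt (real p)"
proof -
  obtain g where g: "residue_primroot p g" using prime_primitive_root_exists[of p] assms by auto
  define P where "P = prime_factors (p - 1)"
  \<comment> \<open>A pair \<open>(S, j)\<close> stands for the \<open>j\<close>-th power of the
    character of order \<open>\<Prod>S\<close>; it is principal exactly for
    \<open>j = 0\<close>.\<close>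
  define I where "I = Sigma (Pow P) (\<lambda>S. {..<\<Prod>S})"
  define w where "w = (\<lambda>(S, j :: nat). (-1) ^ card S / of_nat (\<Prod>S) :: complex)"
  define \<chi> where "\<chi> = (\<lambda>(S, j). log_char p g (\<Prod>S) j)"
  define I0 where "I0 = {(S :: nat set, j :: nat). j = 0}"
  have finP: "finite P" by (simp add: P_def)
  have finI: "finite I" using finP by (auto simp: I_def)
  have dpos: "\<Prod>S > 0" if "S \<subseteq> P" for S
    using that by (intro prod_pos) (auto simp: P_def in_prime_factors_iff prime_gt_0_nat)
  have ddvd: "\<Prod>S dvd p - 1" if "S \<subseteq> P" for S
  proof -
    have "\<Prod>S dvd \<Prod>P" using that finP by (rule prod_dvd_prod_subset[rotated])
    also have "\<Prod>P dvd (\<Prod>q\<in>P. q ^ multiplicity q (p - 1))"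
    proof (rule prod_dvd_prod)
      fix q assume "q \<in> P"
      then show "q dvd q ^ multiplicity q (p - 1)"
        by (intro dvd_power) (simp add: P_def prime_factors_multiplicity)
    qed
    also have "\<dots> = p - 1" unfolding P_def using assms(2) by (intro prime_factorization_nat[symmetric]) simp
    finally show ?thesis .
  qed
  have \<chi>: "dirichlet_char (int p) (\<chi> i)" if "i \<in> I" for i
    using that dpos ddvd dirichlet_char_log_char[OF assms(1) g] by (auto simp: I_def \<chi>_def)
  have ind: "complex_of_real (primroot_indicator p x) = (\<Sum>i\<in>I. w i * \<chi> i x)" for x
  proof (cases "int p dvd x")
    case True
    then have "(\<Sum>i\<in>I. w i * \<chi> i x) = 0"
      by (intro sum.neutral) (auto simp: \<chi>_def log_char_def)
    moreover have "primroot_indicator p x = 0"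
      using True assms by (simp add: primroot_indicator_def dvd_eq_mod_eq_0)
    ultimately show ?thesis by simp
  next
    case False
    define i where "i = discrete_log p g x"
    have "complex_of_real (primroot_indicator p x) = of_bool (coprime i (p - 1))"
      using primroot_indicator_eq_coprime[OF assms(1) g False] by (simp add: i_def)
    also have "\<dots> = (\<Sum>S\<in>Pow P. (-1) ^ card S * of_bool (\<Prod>S dvd i))"
      unfolding P_def using assms(2) by (intro of_bool_coprime_eq_sum) simp
    also have "\<dots> = (\<Sum>S\<in>Pow P. \<Sum>j<\<Prod>S. w (S, j) * \<chi> (S, j) x)"
    proof (intro sum.cong refl)
      fix S assume S: "S \<in> Pow P"
      have "(\<Sum>j<\<Prod>S. w (S, j) * \<chi> (S, j) x) =
          (-1) ^ card S / of_nat (\<Prod>S) * (\<Sum>j<\<Prod>S. cis (2 * pi * real j * real i / real (\<Prod>S)))"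
        using False by (simp add: w_def \<chi>_def log_char_def i_def sum_distrib_left)
      then show "(-1) ^ card S * of_bool (\<Prod>S dvd i) = (\<Sum>j<\<Prod>S. w (S, j) * \<chi> (S, j) x)"
        using dpos[of S] S by (simp add: sum_cis_eq_of_bool_dvd del: of_nat_prod)
    qed
    also have "\<dots> = (\<Sum>i\<in>I. w i * \<chi> i x)"
      unfolding I_def using finP by (subst sum.Sigma) auto
    finally show ?thesis .
  qed
  \<comment> \<open>For each \<open>S\<close> there are \<open>\<Prod>S\<close> weights of absolute
    value \<open>1 / \<Prod>S\<close>, so each subset of \<open>P\<close> contributes 1.\<close>
  have w_norm: "(\<Sum>i\<in>I. norm (w i)) = 2 ^ card P"
  proof -
    have "(\<Sum>i\<in>I. norm (w i)) = (\<Sum>S\<in>Pow P. \<Sum>j<\<Prod>S. norm (w (S, j)))"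
      unfolding I_def using finP by (subst sum.Sigma) auto
    also have "\<dots> = (\<Sum>S\<in>Pow P. 1)"
    proof (intro sum.cong refl)
      fix S assume "S \<in> Pow P"
      then show "(\<Sum>j<\<Prod>S. norm (w (S, j))) = 1"
        using dpos[of S] by (simp add: w_def norm_divide norm_power del: of_nat_prod)
    qed
    also have "\<dots> = 2 ^ card P" using finP by (simp add: card_Pow)
    finally show ?thesis .
  qed
  have w_triv: "(\<Sum>i\<in>I \<inter> I0. w i) = complex_of_real (real (totient (p - 1)) / real (p - 1))"
  proof -
    have "I \<inter> I0 = (\<lambda>S. (S, 0)) ` Pow P" using dpos by (auto simp: I_def I0_def)
    then have "(\<Sum>i\<in>I \<inter> I0. w i) = (\<Sum>S\<in>Pow P. w (S, 0))"
      by (simp add: sum.reindex inj_on_def)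
    also have "\<dots> = (\<Sum>S\<in>Pow P. (-1) ^ card S * (\<Prod>q\<in>S. 1 / of_nat q) * (\<Prod>q\<in>P - S. 1))"
      by (simp add: w_def prod_dividef)
    also have "\<dots> = (\<Prod>q\<in>P. 1 - 1 / of_nat q)"
      by (rule prod_diff_conv_sum[OF finP, symmetric])
    also have "\<dots> = complex_of_real (\<Prod>q\<in>P. 1 - 1 / real q)" by simp
    also have "(\<Prod>q\<in>P. 1 - 1 / real q) = real (totient (p - 1)) / real (p - 1)"
      unfolding P_def totient_formula2 using assms(2) by simp
    finally show ?thesis .
  qed
  have "norm ((\<Sum>x\<in>{0..<int p}. complex_of_real (primroot_indicator p x) * complex_of_real (primroot_indicator p (x + h))) -
      (\<Sum>i\<in>I \<inter> I0. w i)\<^sup>2 * (of_int (int p) - 2))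
    \<le> (\<Sum>i\<in>I. norm (w i))\<^sup>2 * sqrt (of_int (int p))"
  proof (rule autocorrelation_bound[OF _ assms(3) finI \<chi> ind])
    show "prime (int p)" using assms(1) by simp
    show "\<chi> i x = 1" if "i \<in> I" "i \<in> I0" "\<not> int p dvd x" for i x
      using that by (auto simp: I0_def \<chi>_def log_char_def)
    \<comment> \<open>The generator \<open>g\<close> is the witness: its discrete logarithm is 1
      modulo \<open>\<Prod>S\<close>, and \<open>0 < j < \<Prod>S\<close>.\<close>
    show "\<exists>a. \<not> int p dvd a \<and> \<chi> i a \<noteq> 1" if i: "i \<in> I" "i \<notin> I0" for i
    proof -
      obtain S j where Sj: "i = (S, j)" "S \<subseteq> P" "j < \<Prod>S" "j \<noteq> 0" using i by (auto simp: I_def I0_def)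
      have cop: "coprime p g" using g by (simp add: residue_primroot_def)
      then have ndvd: "\<not> int p dvd int g" using assms(1)
        by (metis coprime_common_divisor dvd_refl int_dvd_int_iff not_prime_unit)
      have "[1 = discrete_log p g (int g)] (mod p - 1)"
        by (rule discrete_log_unique[OF assms(1) g]) simp
      then have "[1 = discrete_log p g (int g)] (mod \<Prod>S)"
        using ddvd[OF Sj(2)] cong_dvd_modulus_nat by blast
      from cis_mod_nat[OF this dpos[OF Sj(2)], of j]
      have "\<chi> i (int g) = cis (2 * pi * real j / real (\<Prod>S))"
        using ndvd Sj by (simp add: \<chi>_def log_char_def)
      moreover have "\<not> \<Prod>S dvd j" using Sj(3,4) by (auto dest: dvd_imp_le)
      ultimately have "\<chi> i (int g) \<noteq> 1" using cis_eq_1_iff_dvd[OF dpos[OF Sj(2)]] by simp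
      then show ?thesis using ndvd by blast
    qed
  qed
  moreover have "(\<Sum>x\<in>{0..<int p}. complex_of_real (primroot_indicator p x) * complex_of_real (primroot_indicator p (x + h))) -
      (\<Sum>i\<in>I \<inter> I0. w i)\<^sup>2 * (of_int (int p) - 2) =
    complex_of_real ((\<Sum>x\<in>{0..<int p}. primroot_indicator p x * primroot_indicator p (x + h)) -
      (real (totient (p - 1)) / real (p - 1))\<^sup>2 * (real p - 2))"
    unfolding w_triv by simp
  moreover have "(2 ^ card P)\<^sup>2 = (4::real) ^ card P" by (simp add: power2_eq_square flip: power_mult_distrib)
  ultimately show ?thesis unfolding w_norm P_def[symmetric] by (simp only: norm_of_real) simp
qed

section \<open>Estimates by the number of prime factors\<close>

text \<open>A largest element added to \<open>k\<close> others from 2 on is at least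
  \<open>k + 2\<close>. Hence its factor is at least \<open>(k + 1) / (k + 2)\<close>, and these
  bounds telescope.\<close>

lemma prod_one_minus_inverse_ge_and_prod_ge_fact:
  fixes S :: "nat set"
  assumes "finite S" "\<And>q. q \<in> S \<Longrightarrow> q \<ge> 2"
  shows "(\<Prod>q\<in>S. 1 - 1 / real q) \<ge> 1 / (real (card S) + 1) \<and> fact (card S) \<le> \<Prod>S"
  using assms
proof (induction S rule: finite_linorder_max_induct)
  case (insert b S)
  define k where "k = card S"
  have "b \<notin> S" using insert.hyps by blast
  have "insert b S \<subseteq> {2..b}" using insert by (auto intro: less_imp_le)
  then have "card (insert b S) \<le> card {2..b}" by (intro card_mono) auto
  then have b: "k + 2 \<le> b" using insert.hyps(1) \<open>b \<notin> S\<close> insert.prems[of b] by (simp add: k_def)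
  have IH: "(\<Prod>q\<in>S. 1 - 1 / real q) \<ge> 1 / (real k + 1)" "fact k \<le> \<Prod>S"
    using insert by (auto simp: k_def)
  have "1 - 1 / (real k + 2) \<le> 1 - 1 / real b" using b by (simp add: frac_le)
  then have "(1 - 1 / (real k + 2)) * (1 / (real k + 1)) \<le> (1 - 1 / real b) * (\<Prod>q\<in>S. 1 - 1 / real q)"
    using IH(1) b by (intro mult_mono) auto
  moreover have "(1 - 1 / (real k + 2)) * (1 / (real k + 1)) = 1 / (real k + 2)"
    by (simp add: field_simps)
  moreover have "fact (Suc k) \<le> b * \<Prod>S" unfolding fact_Suc of_nat_id
    using IH(2) b by (intro mult_le_mono) auto
  ultimately show ?case using insert.hyps(1) \<open>b \<notin> S\<close> by (simp add: k_def add.commute)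
qed auto

lemma fact_card_prime_factors_le:
  assumes "n > 0" shows "fact (card (prime_factors n)) \<le> (n::nat)"
proof -
  have "fact (card (prime_factors n)) \<le> \<Prod>(prime_factors n)"
    using prod_one_minus_inverse_ge_and_prod_ge_fact[of "prime_factors n"]
    by (auto simp: in_prime_factors_iff prime_ge_2_nat)
  also have "\<dots> \<le> (\<Prod>q\<in>prime_factors n. q ^ multiplicity q n)"
    by (intro prod_mono conjI self_le_power)
      (auto simp: prime_factors_multiplicity prime_ge_Suc_0_nat)
  also have "\<dots> = n" using assms by (intro prime_factorization_nat[symmetric])
  finally show ?thesis .
qed

text \<open>Factorials outgrow exponentials. If the number of prime factors is at least
  \<open>K\<close>, its factorial is the intermediate bound; otherwise the left side is at most the
  constant \<open>C * a ^ K\<close>.\<close>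

lemma power_card_prime_factors_le:
  fixes a C :: real
  assumes "a \<ge> 1" "C > 0"
  shows "\<exists>n0. \<forall>n\<ge>n0. C * a ^ card (prime_factors n) \<le> real n"
proof -
  have "(\<lambda>k. inverse (fact k) * a ^ k) \<longlonglongrightarrow> 0"
    using summable_exp summable_LIMSEQ_zero by blast
  then have "eventually (\<lambda>k. inverse (fact k) * a ^ k < 1 / C) sequentially"
    using assms by (intro order_tendstoD) auto
  then obtain K where K: "\<And>k. k \<ge> K \<Longrightarrow> inverse (fact k) * a ^ k < 1 / C"
    by (auto simp: eventually_at_top_linorder)
  obtain n0 where n0: "C * a ^ K \<le> real n0" using real_arch_simple by blast
  have "C * a ^ card (prime_factors n) \<le> real n" if "n \<ge> max 1 n0" for n
  proof (cases "card (prime_factors n) \<ge> K")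
    case True
    define k where "k = card (prime_factors n)"
    have "C * a ^ k \<le> fact k"
      using K[of k] True assms by (simp add: k_def field_simps)
    also have "fact k \<le> real n"
    proof -
      have "fact k \<le> n" using fact_card_prime_factors_le[of n] that unfolding k_def by simp
      then have "real (fact k) \<le> real n" by (simp only: of_nat_le_iff)
      then show ?thesis by simp
    qed
    finally show ?thesis by (simp add: k_def)
  next
    case False
    then have "a ^ card (prime_factors n) \<le> a ^ K" using assms by (intro power_increasing) auto
    then have "C * a ^ card (prime_factors n) \<le> C * a ^ K" using assms by simp
    then show ?thesis using n0 that by linarith
  qed
  then show ?thesis by blast
qed

lemma totient_ratio_ge:
  assumes "n > 0"
  shows "real (totient n) / real n \<ge> 1 / (real (card (prime_factors n)) + 1)"
proof -
  have "(\<Prod>q\<in>prime_factors n. 1 - 1 / real q) \<ge> 1 / (real (card (prime_factors n)) + 1)"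
    using prod_one_minus_inverse_ge_and_prod_ge_fact[of "prime_factors n"]
    by (auto simp: in_prime_factors_iff prime_ge_2_nat)
  then show ?thesis using assms unfolding totient_formula2 by simp
qed

text \<open>The prime 2 alone contributes the factor 1/2. This keeps
  \<open>\<delta> * (1 - \<delta>)\<close> at least \<open>\<delta> / 2\<close> in the second
  moment.\<close>

lemma totient_ratio_le_half:
  assumes "n > 0" "even n"
  shows "real (totient n) / real n \<le> 1 / 2"
proof -
  have "2 \<in> prime_factors n" using assms by (simp add: in_prime_factors_iff)
  then have "(\<Prod>q\<in>prime_factors n. 1 - 1 / real q) =
      (1 - 1 / real 2) * (\<Prod>q\<in>prime_factors n - {2}. 1 - 1 / real q)"
    by (intro prod.remove) auto
  also have "\<dots> \<le> (1 - 1 / real 2) * 1"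
  proof (intro mult_left_mono prod_le_1)
    fix q assume "q \<in> prime_factors n - {2}"
    then have "q \<ge> 2" by (simp add: in_prime_factors_iff prime_ge_2_nat)
    then show "0 \<le> 1 - 1 / real q \<and> 1 - 1 / real q \<le> 1" by simp
  qed auto
  finally show ?thesis using assms by (simp add: totient_formula2)
qed

subsection \<open>Parities of consecutive primitive roots\<close>

text \<open>Neighbours in \<open>G\<close> carry opposite signs, so the partial sums switch between
  0 and the sign \<open>c\<close> of the least element.\<close>

lemma alternating_prefix_sums:
  fixes G :: "nat set"
  assumes alt: "\<And>x y. x \<in> G \<Longrightarrow> y \<in> G \<Longrightarrow> x < y \<Longrightarrow> (\<And>z. z \<in> G \<Longrightarrow> \<not> (x < z \<and> z < y)) \<Longrightarrow> odd (x + y)"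
  shows "\<exists>c\<in>{-1, 1 :: real}. \<forall>b. (\<Sum>y<b. (-1) ^ y * of_bool (y \<in> G)) \<in> {0, c}"
proof (cases "G = {}")
  case False
  define m0 where "m0 = (LEAST m. m \<in> G)"
  have m0: "m0 \<in> G" "\<And>m. m \<in> G \<Longrightarrow> m0 \<le> m"
    using False by (auto simp: m0_def intro: LeastI Least_le)
  define A where "A = (\<lambda>b. \<Sum>y<b. (-1) ^ y * of_bool (y \<in> G) :: real)"
  define c :: real where "c = (-1) ^ m0"
  \<comment> \<open>The invariant: before the first element the sum is 0; afterwards the parity of
    the last element \<open>m\<close> below \<open>b\<close> decides between \<open>c\<close> and
    0.\<close>
  have "(\<forall>y\<in>G. y \<ge> b) \<and> A b = 0 \<or>
    (\<exists>m\<in>G. m < b \<and> (\<forall>z\<in>G. z < b \<longrightarrow> z \<le> m) \<and> A b = (if even m = even m0 then c else 0))" for b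
  proof (induction b)
    case 0
    then show ?case by (simp add: A_def)
  next
    case (Suc b)
    have A_Suc: "A (Suc b) = A b + (-1) ^ b * of_bool (b \<in> G)"
      unfolding A_def by (rule sum.lessThan_Suc)
    show ?case
    proof (cases "b \<in> G")
      case False
      then have A': "A (Suc b) = A b" using A_Suc by simp
      have lt: "z < Suc b \<longleftrightarrow> z < b" "b \<le> z \<longleftrightarrow> Suc b \<le> z" if "z \<in> G" for z
        using that False by (auto simp: less_Suc_eq Suc_le_eq le_less)
      show ?thesis using Suc unfolding A' using lt by (metis less_Suc_eq)
    next
      case True
      from Suc show ?thesis
      proof (elim disjE bexE conjE)
        assume *: "\<forall>y\<in>G. b \<le> y" "A b = 0"
        then have "m0 = b" using m0 True by (meson antisym)
        then have "A (Suc b) = (if even b = even m0 then c else 0)"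
          using A_Suc True * by (simp add: c_def)
        then show ?thesis using True by (intro disjI2 bexI[of _ b]) auto
      next
        fix m assume m: "m \<in> G" "m < b" "\<forall>z\<in>G. z < b \<longrightarrow> z \<le> m"
          "A b = (if even m = even m0 then c else 0)"
        have "odd (m + b)" using m True by (intro alt) (auto simp: not_less)
        then have "A (Suc b) = (if even b = even m0 then c else 0)"
          using A_Suc True m(4) by (cases "even m0"; cases "even b") (auto simp: c_def)
        then show ?thesis using True by (intro disjI2 bexI[of _ b]) auto
      qed
    qed
  qed
  then have "A b \<in> {0, c}" for b by (metis insert_iff)
  moreover have "c \<in> {-1, 1}" by (cases "even m0") (auto simp: c_def)
  ultimately show ?thesis unfolding A_def by blast
qed auto

text \<open>A window of at most \<open>p\<close> residues passes \<open>p\<close> at most once and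
  so splits into at most two intervals. On each the sum is, up to sign, a difference of two prefix
  sums, hence at most 1 in absolute value.\<close>

lemma alternating_window_le_2:
  fixes G :: "nat set"
  assumes alt: "\<And>x y. x \<in> G \<Longrightarrow> y \<in> G \<Longrightarrow> x < y \<Longrightarrow> (\<And>z. z \<in> G \<Longrightarrow> \<not> (x < z \<and> z < y)) \<Longrightarrow> odd (x + y)"
    and "x < p" "H \<le> p"
  shows "\<bar>\<Sum>i<H. (-1) ^ i * of_bool ((x + i) mod p \<in> G) :: real\<bar> \<le> 2"
proof -
  define A where "A = (\<lambda>b. \<Sum>y<b. (-1) ^ y * of_bool (y \<in> G) :: real)"
  obtain c :: real where c: "c \<in> {-1, 1}" "\<And>b. A b \<in> {0, c}"
    using alternating_prefix_sums[OF alt] unfolding A_def by blast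
  have diff: "\<bar>A a - A b\<bar> \<le> 1" for a b using c(1) c(2)[of a] c(2)[of b] by auto
  have window: "(\<Sum>i<k. (-1) ^ i * of_bool (y + i \<in> G)) = (-1) ^ y * (A (y + k) - A y)" for y k
  proof (induction k)
    case (Suc k)
    have "A (y + Suc k) = A (y + k) + (-1) ^ (y + k) * of_bool (y + k \<in> G)"
      unfolding A_def add_Suc_right by (rule sum.lessThan_Suc)
    moreover have "(-1) ^ y * (-1) ^ (y + k) = (-1 :: real) ^ k"
      by (simp add: power_add flip: mult.assoc power_mult_distrib)
    ultimately have "(-1) ^ y * (A (y + Suc k) - A y) = (-1) ^ y * (A (y + k) - A y) + (-1) ^ k * of_bool (y + k \<in> G)"
      by (simp only: right_diff_distrib distrib_left mult.assoc[symmetric])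
    then show ?case unfolding sum.lessThan_Suc Suc by (rule sym)
  qed simp
  have one: "\<bar>\<Sum>i<k. (-1) ^ i * of_bool (y + i \<in> G) :: real\<bar> \<le> 1" for y k
    unfolding window using diff by (simp add: abs_mult)
  show ?thesis
  proof (cases "x + H \<le> p")
    case True
    have "(\<Sum>i<H. (-1) ^ i * of_bool ((x + i) mod p \<in> G) :: real) = (\<Sum>i<H. (-1) ^ i * of_bool (x + i \<in> G))"
      using True by (intro sum.cong) auto
    then show ?thesis using one[of x H] by simp
  next
    case False
    define k where "k = p - x"
    have k: "k \<le> H" "x + k = p" using False assms by (auto simp: k_def)
    have "(\<Sum>i<H. (-1) ^ i * of_bool ((x + i) mod p \<in> G) :: real) =
      (\<Sum>i<k. (-1) ^ i * of_bool ((x + i) mod p \<in> G)) + (\<Sum>i<H - k. (-1) ^ (k + i) * of_bool ((x + (k + i)) mod p \<in> G))"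
    proof -
      have "(\<Sum>i<k + l. F i) = (\<Sum>i<k. F i) + (\<Sum>i<l. F (k + i))" for F :: "nat \<Rightarrow> real" and l
        by (induction l) (simp_all add: ac_simps)
      from this[of _ "H - k"] show ?thesis using k(1) by simp
    qed
    also have "(\<Sum>i<k. (-1) ^ i * of_bool ((x + i) mod p \<in> G) :: real) = (\<Sum>i<k. (-1) ^ i * of_bool (x + i \<in> G))"
      using k by (intro sum.cong) auto
    also have "(\<Sum>i<H - k. (-1) ^ (k + i) * of_bool ((x + (k + i)) mod p \<in> G) :: real) =
        (-1) ^ k * (\<Sum>i<H - k. (-1) ^ i * of_bool (0 + i \<in> G))"
      unfolding sum_distrib_left
    proof (intro sum.cong refl)
      fix i assume "i \<in> {..<H - k}"
      then have "i < p" "x + (k + i) = p + i" using assms k by auto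
      then have "(x + (k + i)) mod p = i" by (simp only: mod_add_self1 mod_less)
      then show "(-1) ^ (k + i) * of_bool ((x + (k + i)) mod p \<in> G) = ((-1) ^ k * ((-1) ^ i * of_bool (0 + i \<in> G)) :: real)"
        by (simp add: power_add)
    qed
    finally have "\<bar>\<Sum>i<H. (-1) ^ i * of_bool ((x + i) mod p \<in> G) :: real\<bar> \<le>
        \<bar>\<Sum>i<k. (-1) ^ i * of_bool (x + i \<in> G) :: real\<bar> +
        \<bar>(-1) ^ k * (\<Sum>i<H - k. (-1) ^ i * of_bool (0 + i \<in> G) :: real)\<bar>"
      by (simp only: abs_triangle_ineq)
    also have "\<dots> \<le> 1 + 1"
      unfolding abs_mult power_abs using one[of x k] one[of 0 "H - k"] by (intro add_mono) simp_all
    finally show ?thesis by simp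
  qed
qed

text \<open>Expanding the square gives signed correlations at the distances \<open>j - i\<close>.
  The \<open>M\<close> terms add up to \<open>M\<close> times the square of an alternating sum,
  which is nonnegative and is dropped.\<close>

lemma second_moment_alternating_windows:
  fixes f :: "int \<Rightarrow> real"
  assumes "p > 0" "\<And>x. f (x mod p) = f x" "int H \<le> p"
    and corr: "\<And>h. \<not> p dvd h \<Longrightarrow> \<bar>(\<Sum>x\<in>{0..<p}. f x * f (x + h)) - M\<bar> \<le> E"
    and "M \<ge> 0" "E \<ge> 0"
  shows "(\<Sum>x\<in>{0..<p}. (\<Sum>i<H. (-1) ^ i * f (x + int i))\<^sup>2) \<ge>
    real H * ((\<Sum>x\<in>{0..<p}. (f x)\<^sup>2) - M) - (real H)\<^sup>2 * E"
proof -
  define N where "N = (\<lambda>h. \<Sum>x\<in>{0..<p}. f x * f (x + h))"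
  have per: "f (x mod p + t) = f (x + t)" for x t by (metis assms(2) mod_add_left_eq)
  have shift: "(\<Sum>x\<in>{0..<p}. f (x + int i) * f (x + int j)) = N (int j - int i)" for i j
  proof -
    have "(\<Sum>x\<in>{0..<p}. f (x + int i) * f ((x + int i) + (int j - int i))) = N (int j - int i)"
      unfolding N_def using assms(1)
      by (rule sum_mod_shift[where f = "\<lambda>x. f x * f (x + (int j - int i))"]) (simp only: assms(2) per)
    then show ?thesis by simp
  qed
  have "(\<Sum>x\<in>{0..<p}. (\<Sum>i<H. (-1) ^ i * f (x + int i))\<^sup>2) =
      (\<Sum>x\<in>{0..<p}. \<Sum>i<H. \<Sum>j<H. (-1) ^ (i + j) * (f (x + int i) * f (x + int j)))"
    by (simp add: power2_eq_square sum_product power_add ac_simps)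
  also have "\<dots> = (\<Sum>i<H. \<Sum>x\<in>{0..<p}. \<Sum>j<H. (-1) ^ (i + j) * (f (x + int i) * f (x + int j)))"
    by (rule sum.swap)
  also have "\<dots> = (\<Sum>i<H. \<Sum>j<H. \<Sum>x\<in>{0..<p}. (-1) ^ (i + j) * (f (x + int i) * f (x + int j)))"
    by (intro sum.cong refl sum.swap)
  also have "\<dots> = (\<Sum>i<H. \<Sum>j<H. (-1) ^ (i + j) * N (int j - int i))"
    by (simp add: shift flip: sum_distrib_left)
  \<comment> \<open>The correction \<open>N 0 - M\<close> on the diagonal lets the \<open>M\<close>
    terms run over all pairs.\<close>
  also have "\<dots> \<ge> (\<Sum>i<H. \<Sum>j<H. (-1) ^ i * (-1) ^ j * M + of_bool (i = j) * (N 0 - M) - E)"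
  proof (intro sum_mono)
    fix i j assume ij: "i \<in> {..<H}" "j \<in> {..<H}"
    show "(-1) ^ i * (-1) ^ j * M + of_bool (i = j) * (N 0 - M) - E \<le> (-1) ^ (i + j) * N (int j - int i)"
    proof (cases "i = j")
      case True
      then show ?thesis using assms(6) by (simp flip: power_mult_distrib)
    next
      case False
      have "\<not> p dvd int j - int i"
      proof
        assume "p dvd int j - int i"
        then have "p \<le> \<bar>int j - int i\<bar>" using False
          by (metis dvd_imp_le_int eq_iff_diff_eq_0 abs_of_pos assms(1) of_nat_eq_iff)
        then show False using ij assms(3) by auto
      qed
      then have "\<bar>N (int j - int i) - M\<bar> \<le> E" using corr by (simp add: N_def)
      then have "\<bar>(-1) ^ (i + j) * (N (int j - int i) - M)\<bar> \<le> E" by (simp add: abs_mult)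
      then show ?thesis using False by (simp add: power_add algebra_simps abs_le_iff)
    qed
  qed
  also have "(\<Sum>i<H. \<Sum>j<H. (-1) ^ i * (-1) ^ j * M + of_bool (i = j) * (N 0 - M) - E) =
      (\<Sum>i<H. \<Sum>j<H. (-1) ^ i * (-1) ^ j) * M + (\<Sum>i<H. \<Sum>j<H. of_bool (i = j)) * (N 0 - M)
        - real H * real H * E"
    by (simp only: sum_subtractf sum.distrib sum_distrib_right) simp
  also have "(\<Sum>i<H. \<Sum>j<H. of_bool (i = j)) = real H"
  proof -
    have "(\<Sum>j<H. of_bool (i = j)) = (1::real)" if "i < H" for i
    proof -
      have "(\<Sum>j<H. of_bool (i = j)) = (\<Sum>j\<in>{i}. 1 :: real)"
        using that by (intro sum.mono_neutral_cong_right) auto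
      then show ?thesis by simp
    qed
    then show ?thesis by simp
  qed
  also have "(\<Sum>i<H. \<Sum>j<H. (-1) ^ i * (-1) ^ j) = (\<Sum>i<H. (-1 :: real) ^ i)\<^sup>2"
    by (simp only: power2_eq_square sum_product)
  finally have "(\<Sum>i<H. (-1 :: real) ^ i)\<^sup>2 * M + real H * (N 0 - M) - real H * real H * E
    \<le> (\<Sum>x\<in>{0..<p}. (\<Sum>i<H. (-1) ^ i * f (x + int i))\<^sup>2)" .
  moreover have "(\<Sum>i<H. (-1 :: real) ^ i)\<^sup>2 * M \<ge> 0" using assms(5) by simp
  moreover have "N 0 = (\<Sum>x\<in>{0..<p}. (f x)\<^sup>2)" by (simp add: N_def power2_eq_square)
  ultimately show ?thesis by (simp add: power2_eq_square)
qed

section \<open>Adjacent primitive roots and parity\<close>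

lemma sum_int_atLeastLessThan: "(\<Sum>x\<in>{0..<int p}. F x) = (\<Sum>x<p. F (int x))"
  by (rule sum.reindex_bij_witness[of _ int nat]) auto

lemma primroot_indicator_int:
  "primroot_indicator p (int n) = of_bool (n mod p \<in> {g. g < p \<and> residue_primroot p g})" if "p > 0"
  using that by (simp add: primroot_indicator_def flip: of_nat_mod)

lemma card_primroots_less:
  assumes "prime p"
  shows "card {g. g < p \<and> residue_primroot p g} = totient (p - 1)"
proof -
  have "{g. g < p \<and> residue_primroot p g} = {g \<in> totatives p. residue_primroot p g}"
    using assms prime_gt_1_nat[of p] by (auto simp: totatives_prime intro!: Nat.gr0I)
  then show ?thesis using card_residue_primroots[of p] prime_primitive_root_exists[of p] assms
    prime_gt_1_nat[of p] by (simp add: totient_prime)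
qed

lemma sum_primroot_indicator:
  assumes "prime p"
  shows "(\<Sum>x\<in>{0..<int p}. primroot_indicator p x) = real (totient (p - 1))"
proof -
  have p: "p > 0" using assms prime_gt_0_nat by blast
  have "(\<Sum>x\<in>{0..<int p}. primroot_indicator p x) = (\<Sum>x<p. of_bool (residue_primroot p x))"
    unfolding sum_int_atLeastLessThan using p
    by (intro sum.cong) (auto simp: primroot_indicator_int)
  also have "\<dots> = (\<Sum>x\<in>{g. g < p \<and> residue_primroot p g}. 1)"
    by (intro sum.mono_neutral_cong_right) auto
  also have "\<dots> = real (card {g. g < p \<and> residue_primroot p g})" by simp
  finally show ?thesis using card_primroots_less[OF assms] by simp
qed

text \<open>If there were no such pair, the count for \<open>h = 1\<close> would be 0 and its main
  term would be bounded by the error term. The lower bound for the totient ratio and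
  \<open>size\<close> exclude this.\<close>

lemma adjacent_primroots:
  assumes "prime p" "p > 2"
    and size: "101 * ((real (card (prime_factors (p - 1))) + 1)\<^sup>2 * 4 ^ card (prime_factors (p - 1))) \<le> sqrt (real p)"
  shows "\<exists>x. x < p \<and> Suc x < p \<and> residue_primroot p x \<and> residue_primroot p (Suc x)"
proof (rule ccontr)
  assume contra: "\<not> ?thesis"
  define w where "w = real (card (prime_factors (p - 1))) + 1"
  define E where "E = 4 ^ card (prime_factors (p - 1)) * sqrt (real p)"
  define \<delta> where "\<delta> = real (totient (p - 1)) / real (p - 1)"
  define r where "r = sqrt (real p)"
  have "primroot_indicator p x * primroot_indicator p (x + 1) = 0" if x: "x \<in> {0..<int p}" for x
  proof -
    obtain n where n: "x = int n" "n < p" using x by (metis atLeastLessThan_iff nonneg_int_cases of_nat_less_iff)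
    have x1: "x + 1 = int (Suc n)" using n by simp
    have "primroot_indicator p (x + 1) = of_bool (Suc n mod p \<in> {g. g < p \<and> residue_primroot p g})"
      unfolding x1 using assms(2) by (intro primroot_indicator_int) simp
    moreover have "primroot_indicator p x = of_bool (n mod p \<in> {g. g < p \<and> residue_primroot p g})"
      unfolding n(1) using assms(2) by (intro primroot_indicator_int) simp
    moreover have "\<not> (residue_primroot p n \<and> Suc n mod p < p \<and> residue_primroot p (Suc n mod p))"
    \<comment> \<open>Here the successor wraps around to 0, which is not a primitive root.\<close>
    proof (cases "Suc n = p")
      case True
      then show ?thesis using assms by simp
    next
      case False
      then show ?thesis using contra n by auto
    qed
    ultimately show ?thesis using n by auto
  qed
  then have "(\<Sum>x\<in>{0..<int p}. primroot_indicator p x * primroot_indicator p (x + 1)) = 0"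
    by (intro sum.neutral) blast
  then have *: "\<delta>\<^sup>2 * (real p - 2) \<le> E"
    using primroot_pair_count[OF assms(1,2), of 1] assms(2) unfolding E_def \<delta>_def
    by (simp add: abs_mult)
  have w: "w \<ge> 1" by (simp add: w_def)
  have "1 / w \<le> \<delta>" unfolding w_def \<delta>_def using assms(2) by (intro totient_ratio_ge) simp
  then have "(1 / w)\<^sup>2 \<le> \<delta>\<^sup>2" using w by (intro power_mono) auto
  then have "(1 / w)\<^sup>2 * (real p - 2) \<le> E"
    using * assms(2) mult_right_mono[of "(1 / w)\<^sup>2" "\<delta>\<^sup>2" "real p - 2"] by linarith
  then have "real p - 2 \<le> w\<^sup>2 * E" using w by (simp add: field_simps)
  also have "\<dots> = (w\<^sup>2 * 4 ^ card (prime_factors (p - 1))) * r" by (simp add: E_def r_def)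
  finally have 1: "real p - 2 \<le> (w\<^sup>2 * 4 ^ card (prime_factors (p - 1))) * r" .
  \<comment> \<open>In these terms \<open>size\<close> gives \<open>101 * X * r \<le> p\<close>,
    against \<open>p - 2 \<le> X * r\<close>.\<close>
  define X where "X = w\<^sup>2 * 4 ^ card (prime_factors (p - 1))"
  have X: "X \<ge> 1 * 1" unfolding X_def using w by (intro mult_mono) auto
  have "101 * X \<le> r" using size by (simp add: X_def w_def r_def)
  then have "101 * X * r \<le> r * r" "r \<ge> 101" using X by (auto intro!: mult_right_mono)
  moreover have "r * r = real p" by (simp add: r_def)
  moreover have "X * r \<ge> 1 * 101" using X \<open>r \<ge> 101\<close> by (intro mult_mono) auto
  ultimately show False using 1 unfolding X_def[symmetric] by linarith
qed

text \<open>If parities of consecutive primitive roots alternated, signed counts of primitive roots in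
  windows would be bounded by 2. The pair counts show that, for windows of length \<open>H\<close>, their
  mean square is about \<open>H \<delta> (1 - \<delta>)\<close> with \<open>\<delta> = \<phi>(p - 1) / (p - 1)\<close>.\<close>

lemma consecutive_primroots_same_parity:
  assumes "prime p" "p > 2"
    and size: "101 * ((real (card (prime_factors (p - 1))) + 1)\<^sup>2 * 4 ^ card (prime_factors (p - 1))) \<le> sqrt (real p)"
  defines "G \<equiv> {g. g < p \<and> residue_primroot p g}"
  shows "\<exists>x\<in>G. \<exists>y\<in>G. x < y \<and> (\<forall>z\<in>G. \<not> (x < z \<and> z < y)) \<and> even (x + y)"
proof (rule ccontr)
  assume contra: "\<not> ?thesis"
  define k where "k = card (prime_factors (p - 1))"
  define w where "w = real k + 1"
  \<comment> \<open>As \<open>\<delta>\<close> is at least \<open>1 / (k + 1)\<close> and at most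
    1/2, this length makes the main term at least \<open>5 * (p - 1)\<close>, above the upper bound
    \<open>4 * p\<close> for large \<open>p\<close>. The error is then \<open>100 * (X * r)\<close>,
    just below the \<open>101 * (X * r)\<close> controlled by \<open>size\<close>.\<close>
  define H where "H = 10 * (k + 1)"
  define E where "E = 4 ^ k * sqrt (real p)"
  define \<delta> where "\<delta> = real (totient (p - 1)) / real (p - 1)"
  define r where "r = sqrt (real p)"
  define X where "X = w\<^sup>2 * 4 ^ k"
  have w: "w \<ge> 1" by (simp add: w_def)
  have X: "X \<ge> w" unfolding X_def power2_eq_square mult.assoc
    using w mult_mono[of 1 w 1 "4 ^ k"] by (simp add: mult_le_cancel_left1)
  have Xr: "101 * X \<le> r" using size by (simp add: X_def w_def r_def k_def)
  have rr: "r * r = real p" by (simp add: r_def)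
  have r: "r \<ge> 101" using X Xr w by linarith
  have "real H \<le> r" using X Xr by (simp add: H_def w_def)
  also have "r \<le> real p" using rr r by (metis mult_left_mono mult.right_neutral order_trans one_le_numeral zero_le_numeral)
  finally have Hp: "H \<le> p" by simp
  have p0: "p > 0" using assms(2) by simp
  have "\<bar>\<Sum>i<H. (-1) ^ i * primroot_indicator p (x + int i)\<bar> \<le> 2" if x: "x \<in> {0..<int p}" for x
  proof -
    obtain n where n: "x = int n" "n < p" using x by (metis atLeastLessThan_iff nonneg_int_cases of_nat_less_iff)
    have "\<bar>\<Sum>i<H. (-1) ^ i * of_bool ((n + i) mod p \<in> G) :: real\<bar> \<le> 2"
      using contra n Hp by (intro alternating_window_le_2) blast+
    then show ?thesis
      using primroot_indicator_int[OF p0] unfolding n(1) G_def by (simp only: of_nat_add[symmetric])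
  qed
  then have "(\<Sum>i<H. (-1) ^ i * primroot_indicator p (x + int i))\<^sup>2 \<le> 4" if "x \<in> {0..<int p}" for x
    using that abs_le_square_iff[of _ "2 :: real"] by fastforce
  then have "(\<Sum>x\<in>{0..<int p}. (\<Sum>i<H. (-1) ^ i * primroot_indicator p (x + int i))\<^sup>2) \<le> (\<Sum>x\<in>{0..<int p}. 4)"
    by (rule sum_mono)
  then have upper: "(\<Sum>x\<in>{0..<int p}. (\<Sum>i<H. (-1) ^ i * primroot_indicator p (x + int i))\<^sup>2) \<le> 4 * real p"
    by simp
  have "(\<Sum>x\<in>{0..<int p}. (\<Sum>i<H. (-1) ^ i * primroot_indicator p (x + int i))\<^sup>2) \<ge>
    real H * ((\<Sum>x\<in>{0..<int p}. (primroot_indicator p x)\<^sup>2) - \<delta>\<^sup>2 * (real p - 2)) - (real H)\<^sup>2 * E"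
  proof (rule second_moment_alternating_windows)
    show "primroot_indicator p (x mod int p) = primroot_indicator p x" for x
      by (simp add: primroot_indicator_def)
    show "\<bar>(\<Sum>x\<in>{0..<int p}. primroot_indicator p x * primroot_indicator p (x + h)) - \<delta>\<^sup>2 * (real p - 2)\<bar> \<le> E"
      if "\<not> int p dvd h" for h
      using primroot_pair_count[OF assms(1,2) that] by (simp add: \<delta>_def E_def k_def)
  qed (use assms(2) Hp in \<open>auto simp: E_def\<close>)
  moreover have "(\<Sum>x\<in>{0..<int p}. (primroot_indicator p x)\<^sup>2) = \<delta> * (real p - 1)"
  proof -
    have "(primroot_indicator p x)\<^sup>2 = primroot_indicator p x" for x by (simp add: primroot_indicator_def)
    then show ?thesis using sum_primroot_indicator[OF assms(1)] assms(2) by (simp add: \<delta>_def)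
  qed
  ultimately have lower: "real H * (\<delta> * (real p - 1) - \<delta>\<^sup>2 * (real p - 2)) - (real H)\<^sup>2 * E \<le> 4 * real p"
    using upper by simp
  have \<delta>: "1 / w \<le> \<delta>" unfolding w_def k_def \<delta>_def using assms(2) by (intro totient_ratio_ge) simp
  have "even (p - 1)" using assms(1,2) prime_odd_nat by fastforce
  then have \<delta>2: "\<delta> \<le> 1 / 2" unfolding \<delta>_def using assms(2) by (intro totient_ratio_le_half) auto
  have \<delta>0: "\<delta> \<ge> 0" by (simp add: \<delta>_def)
  have "\<delta>\<^sup>2 * (real p - 2) \<le> (1 / 2 * \<delta>) * (real p - 1)"
    unfolding power2_eq_square using \<delta>2 \<delta>0 assms(2) by (intro mult_mono) auto
  then have "\<delta> * (real p - 1) / 2 \<le> \<delta> * (real p - 1) - \<delta>\<^sup>2 * (real p - 2)" by simp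
  moreover have "1 / w * (real p - 1) \<le> \<delta> * (real p - 1)" using \<delta> assms(2) by (intro mult_right_mono) auto
  then have "1 / w * (real p - 1) / 2 \<le> \<delta> * (real p - 1) / 2" by (rule divide_right_mono) simp
  ultimately have "1 / w * (real p - 1) / 2 \<le> \<delta> * (real p - 1) - \<delta>\<^sup>2 * (real p - 2)"
    by (meson order_trans)
  then have "real H * (1 / w * (real p - 1) / 2) \<le> real H * (\<delta> * (real p - 1) - \<delta>\<^sup>2 * (real p - 2))"
    by (intro mult_left_mono) auto
  moreover have H: "real H = 10 * w" by (simp add: H_def w_def)
  then have "real H * (1 / w * (real p - 1) / 2) = 5 * (real p - 1)" using w by simp
  moreover have "(real H)\<^sup>2 * E = 100 * (X * r)"
    unfolding H by (simp add: E_def X_def r_def power_mult_distrib)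
  ultimately have "5 * (real p - 1) - 100 * (X * r) \<le> 4 * real p" using lower by linarith
  moreover have "101 * (X * r) \<le> r * r" using mult_right_mono[OF Xr, of r] r by (simp add: mult.assoc)
  moreover have "X * r \<ge> 1 * 101" using X w r by (intro mult_mono) auto
  moreover define Y where "Y = X * r"
  ultimately have "5 * (real p - 1) - 100 * Y \<le> 4 * real p" "101 * Y \<le> real p" "Y \<ge> 101"
    using rr by simp_all
  \<comment> \<open>The first two bounds give \<open>101 * Y \<le> p \<le> 100 * Y + 5\<close>, so
    \<open>Y\<close> would be at most 5.\<close>
  then show False by argo
qed

text \<open>From \<open>k + 1 \<le> 2 ^ k\<close> the left side is at most
  \<open>101 * 16 ^ k\<close>, whose square is \<open>10201 * 256 ^ k\<close>.\<close>

lemma eventually_prime_factors_small: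
  "\<exists>p0. \<forall>p\<ge>p0. 101 * ((real (card (prime_factors (p - 1))) + 1)\<^sup>2 * 4 ^ card (prime_factors (p - 1))) \<le> sqrt (real p)"
proof -
  obtain n0 where n0: "\<And>n. n \<ge> n0 \<Longrightarrow> 10201 * 256 ^ card (prime_factors n) \<le> real n"
    using power_card_prime_factors_le[of 256 10201] by auto
  have "101 * ((real (card (prime_factors (p - 1))) + 1)\<^sup>2 * 4 ^ card (prime_factors (p - 1))) \<le> sqrt (real p)"
    if p: "p \<ge> n0 + 1" for p
  proof (rule real_le_rsqrt)
    define k where "k = card (prime_factors (p - 1))"
    have "k + 1 \<le> 2 ^ k" by (induction k) auto
    then have "real (k + 1) \<le> real (2 ^ k)" by (simp only: of_nat_le_iff)
    then have "(real k + 1)\<^sup>2 \<le> (2 ^ k)\<^sup>2" by (intro power_mono) auto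
    also have "\<dots> = (4::real) ^ k" by (simp add: power2_eq_square flip: power_mult_distrib)
    finally have "(real k + 1)\<^sup>2 * 4 ^ k \<le> (4::real) ^ k * 4 ^ k" by (intro mult_right_mono) auto
    then have "(101 * ((real k + 1)\<^sup>2 * 4 ^ k))\<^sup>2 \<le> (101 * (4 ^ k * 4 ^ k))\<^sup>2"
      by (intro power_mono mult_left_mono) auto
    also have "\<dots> = 10201 * (256::real) ^ k" by (simp add: power2_eq_square flip: power_mult_distrib)
    also have "\<dots> \<le> real (p - 1)" unfolding k_def using p by (intro n0) auto
    also have "\<dots> \<le> real p" by simp
    finally show "(101 * ((real (card (prime_factors (p - 1))) + 1)\<^sup>2 * 4 ^ card (prime_factors (p - 1))))\<^sup>2 \<le> real p"
      by (simp add: k_def)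
  qed
  then show ?thesis by blast
qed

subsection \<open>The sequence of primitive roots\<close>

text \<open>The bounds remove only 0, 1 and \<open>p - 1\<close>: the first is not coprime to
  \<open>p\<close>, the others have order at most 2, while \<open>p - 1\<close> is at least
  4.\<close>

lemma primroots_eq:
  assumes "prime p" "p \<ge> 5"
  shows "{g. 1 < g \<and> g < p - 1 \<and> residue_primroot p g} = {g. g < p \<and> residue_primroot p g}"
proof -
  have "g \<noteq> 0 \<and> g \<noteq> 1 \<and> g \<noteq> p - 1" if "residue_primroot p g" for g
  proof (intro conjI notI)
    have tot: "ord p g = p - 1" using that assms(1) by (simp add: residue_primroot_def totient_prime)
    show False if "g = 0" using that \<open>residue_primroot p g\<close> assms by simp
    show False if "g = 1" using that tot assms(2) by simp
    show False if "g = p - 1"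
    proof -
      have "g\<^sup>2 = p * (p - 2) + 1" using that assms(2)
        by (auto simp: power2_eq_square algebra_simps elim!: le_Suc_ex[THEN exE])
      then have "[g ^ 2 = 1] (mod p)" by (simp add: cong_altdef_nat)
      then have "p - 1 dvd 2" using tot ord_divides by metis
      then show False using assms(2) by (auto dest: dvd_imp_le)
    qed
  qed
  then have "(1 < g \<and> g < p - 1 \<and> residue_primroot p g) = (g < p \<and> residue_primroot p g)" for g
    by (cases "residue_primroot p g") force+
  then show ?thesis by (intro Collect_cong)
qed

text \<open>Even powers of \<open>x\<close> and \<open>-x\<close> agree. If \<open>d\<close> is the
  order of \<open>-x\<close>, then \<open>p - 1\<close> divides \<open>2 * d\<close>; as 4 divides
  \<open>p - 1\<close>, \<open>d\<close> is even, so the \<open>d\<close>-th power of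
  \<open>x\<close> is 1 as well.\<close>

lemma residue_primroot_uminus:
  assumes "prime p" "[p = 1] (mod 4)" "residue_primroot p x" "x < p"
  shows "residue_primroot p (p - x)"
proof -
  have cop: "coprime p x" and ordx: "ord p x = p - 1"
    using assms by (auto simp: residue_primroot_def totient_prime)
  have p1: "p > 1" using assms(1) prime_gt_1_nat by blast
  have cop': "coprime p (p - x)" using cop assms(4)
    by (metis coprime_iff_gcd_eq_1 gcd.commute gcd_diff2_nat less_imp_le coprime_commute)
  define d where "d = ord p (p - x)"
  have "4 dvd p - 1" using assms(2) p1 by (simp add: cong_altdef_nat)
  have "[int (p - x) ^ 2 = int x ^ 2] (mod int p)"
  proof -
    have "int (p - x) ^ 2 - int x ^ 2 = int p * (int p - 2 * int x)"
      using assms(4) by (simp add: of_nat_diff power2_eq_square algebra_simps)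
    then show ?thesis by (simp add: cong_iff_dvd_diff)
  qed
  then have sq: "[(p - x) ^ 2 = x ^ 2] (mod p)" by (metis cong_int_iff of_nat_power)
  have pow: "[(p - x) ^ (2 * m) = x ^ (2 * m)] (mod p)" for m
    using cong_pow[OF sq, of m] by (simp add: power_mult)
  have one: "[(p - x) ^ d = 1] (mod p)" using ord d_def by blast
  have "[(p - x) ^ (2 * d) = 1] (mod p)"
    using ord_divides[of "p - x" "2 * d" p] by (simp add: d_def)
  then have "[x ^ (2 * d) = 1] (mod p)" using pow[of d] cong_sym cong_trans by blast
  then have "p - 1 dvd 2 * d" using ordx ord_divides by metis
  then have "2 * 2 dvd 2 * d" using \<open>4 dvd p - 1\<close> dvd_trans[of 4 "p - 1" "2 * d"] by simp
  then have "even d" by (simp only: dvd_times_left_cancel_iff)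
  then obtain m where m: "d = 2 * m" by blast
  then have "[x ^ d = 1] (mod p)" using pow[of m] one cong_sym cong_trans by metis
  then have "p - 1 dvd d" using ordx ord_divides by metis
  moreover have "d dvd p - 1"
    using order_divides_totient[OF cop'] assms(1) by (simp add: d_def totient_prime)
  ultimately have "d = p - 1" by (simp add: dvd_antisym)
  then show ?thesis using cop' p1 assms(1) by (simp add: residue_primroot_def d_def totient_prime)
qed

lemma sorted_list_consecutive:
  fixes G :: "'a :: linorder set"
  assumes "finite G" "x \<in> G" "y \<in> G" "x < y" "\<And>z. z \<in> G \<Longrightarrow> \<not> (x < z \<and> z < y)"
  shows "\<exists>k. k + 1 < card G \<and> sorted_list_of_set G ! k = x \<and> sorted_list_of_set G ! (k + 1) = y"
proof -
  define l where "l = sorted_list_of_set G"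
  have l: "set l = G" "length l = card G" "sorted_wrt (<) l"
    using assms(1) by (auto simp: l_def strict_sorted_list_of_set)
  obtain i j where ij: "i < length l" "l ! i = x" "j < length l" "l ! j = y"
    using assms(2,3) l(1) by (metis in_set_conv_nth)
  have "i < j"
  proof (rule ccontr)
    assume "\<not> i < j"
    then have "l ! j \<le> l ! i" using l(3) ij by (metis less_imp_le linorder_neqE_nat order_refl sorted_wrt_nth_less)
    then show False using ij assms(4) by simp
  qed
  have "j = i + 1"
  proof (rule ccontr)
    assume "j \<noteq> i + 1"
    then have "i < i + 1" "i + 1 < j" using \<open>i < j\<close> by auto
    then have "x < l ! (i + 1)" "l ! (i + 1) < y" "l ! (i + 1) \<in> G"
      using l ij sorted_wrt_nth_less[OF l(3)] nth_mem[of "i + 1" l] by auto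
    then show False using assms(5) by blast
  qed
  then show ?thesis using ij l(2) unfolding l_def by auto
qed

lemma of_nat_bit_eq: "(of_nat n :: bit) = of_bool (odd n)"
  by (induction n) auto

text \<open>Each inner term occurs twice and cancels modulo 2.\<close>

lemma sum_adjacent_bits:
  fixes g :: "nat \<Rightarrow> nat"
  shows "(\<Sum>n<T. of_nat (g n + g (n + 1)) :: bit) = of_nat (g 0) + of_nat (g T)"
  by (induction T) (auto simp: of_nat_bit_eq)

text \<open>Two adjacent integers that are primitive roots produce a term 1, two consecutive
  primitive roots of equal parity a term 0, so the sequence is not constant.\<close>

lemma primroot_sequence_lower_bound:
  assumes "prime p" "p \<ge> 11"
    and size: "101 * ((real (card (prime_factors (p - 1))) + 1)\<^sup>2 * 4 ^ card (prime_factors (p - 1))) \<le> sqrt (real p)"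
  defines "T \<equiv> totient (p - 1) - 1"
  shows "\<exists>q\<in>prime_factors T. ord q 2 + of_bool ([p = 1] (mod 4)) \<le> linear_complexity (primroot_sequence p)"
    and "linear_complexity (primroot_sequence p) \<le> T"
proof -
  define G where "G = {g. g < p \<and> residue_primroot p g}"
  define l where "l = primitive_roots p"
  define s where "s = primroot_sequence p"
  have finG: "finite G" by (simp add: G_def)
  have l_G: "l = sorted_list_of_set G"
    using primroots_eq[OF assms(1)] assms(2) by (simp add: l_def primitive_roots_def G_def)
  have "totient (p - 1) > 1" using assms(2) by (intro totient_gt_1) simp
  moreover have "even (totient (p - 1))" using assms(2) by (intro totient_even) simp
  ultimately have T: "odd T" "T > 0" and cardG: "card G = T + 1"
    using card_primroots_less[OF assms(1)] by (auto simp: T_def G_def)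
  have s: "s n = of_nat (l ! n + l ! (n + 1))" if "n < T" for n
    using that by (simp add: s_def primroot_sequence_def Let_def l_def T_def)
  have per: "s (n + T) = s n" for n
    by (simp add: s_def primroot_sequence_def T_def)
  show "linear_complexity (primroot_sequence p) \<le> T"
    using lin_rec_linear_complexity(2)[OF T(2), of s] per by (simp add: s_def)
  have pairs: "\<exists>k<T. s k = of_nat (x + y)"
    if "x \<in> G" "y \<in> G" "x < y" "\<And>z. z \<in> G \<Longrightarrow> \<not> (x < z \<and> z < y)" for x y
  proof -
    have "\<exists>k. k + 1 < card G \<and> l ! k = x \<and> l ! (k + 1) = y"
      unfolding l_G by (rule sorted_list_consecutive[OF finG that])
    then obtain k where "k + 1 < card G" "l ! k = x" "l ! (k + 1) = y" by blast
    then show ?thesis using s[of k] cardG by (intro exI[of _ k]) auto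
  qed
  have p2: "p > 2" using assms(2) by simp
  obtain x where "x \<in> G" "Suc x \<in> G"
    using adjacent_primroots[OF assms(1) p2 size] by (auto simp: G_def)
  then obtain k where "s k = of_nat (x + Suc x)" using pairs[of x "Suc x"] by auto
  then have k: "s k = 1" by (simp add: of_nat_bit_eq)
  obtain y z where "y \<in> G" "z \<in> G" "y < z" "\<forall>u\<in>G. \<not> (y < u \<and> u < z)" "even (y + z)"
    using consecutive_primroots_same_parity[OF assms(1) p2 size] unfolding G_def by blast
  then obtain k' where "s k' = of_nat (y + z)" "even (y + z)" using pairs[of y z] by blast
  then have k': "s k' = 0" by (simp only: of_nat_bit_eq) simp
  obtain m where "s m \<noteq> s 0" using k k' by (metis zero_neq_one)
  from linear_complexity_lower_bound[of T s, OF T(1) per this]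
  obtain q where q: "q \<in> prime_factors T" "ord q 2 + of_bool ((\<Sum>n<T. s n) = 1) \<le> linear_complexity s"
    by blast
  have "(\<Sum>n<T. s n) = 1" if p4: "[p = 1] (mod 4)"
  proof -
    have ll: "length l = T + 1" "set l = G" "sorted l" using finG cardG by (auto simp: l_G)
    have refl: "p - x \<in> G" if "x \<in> G" for x
    proof -
      have "x \<noteq> 0" using that assms(1) by (intro notI) (simp add: G_def)
      then show ?thesis using that residue_primroot_uminus[OF assms(1) p4, of x] by (auto simp: G_def)
    qed
    have first: "l ! 0 \<le> x" and last: "x \<le> l ! T" if x: "x \<in> G" for x
    proof -
      obtain i where "i < length l" "l ! i = x" using x ll(2) by (metis in_set_conv_nth)
      then show "l ! 0 \<le> x" "x \<le> l ! T" using ll by (auto intro!: sorted_nth_mono)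
    qed
    have mem: "l ! 0 \<in> G" "l ! T \<in> G" using ll nth_mem[of _ l] by auto
    then have "l ! 0 < p" "l ! T < p" by (auto simp: G_def)
    \<comment> \<open>The reflection of \<open>x\<close> to \<open>p - x\<close> preserves
      \<open>G\<close>, so it exchanges the least and the greatest element.\<close>
    moreover have "l ! 0 \<le> p - l ! T" "p - l ! 0 \<le> l ! T" using first last refl mem by auto
    ultimately have "l ! 0 + l ! T = p" by linarith
    moreover have "odd p" using assms(1) p2 prime_odd_nat by blast
    moreover have "(\<Sum>n<T. s n) = of_nat (l ! 0 + l ! T)"
      using s sum_adjacent_bits[of "(!) l" T] by simp
    ultimately show ?thesis by (simp only: of_nat_bit_eq not_False_eq_True of_bool_eq)
  qed
  then have "of_bool ([p = 1] (mod 4)) \<le> (of_bool ((\<Sum>n<T. s n) = 1) :: nat)" by simp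
  then show "\<exists>q\<in>prime_factors T. ord q 2 + of_bool ([p = 1] (mod 4)) \<le> linear_complexity (primroot_sequence p)"
    using q unfolding s_def by (intro bexI[of _ q]) linarith
qed

theorem proposition1:
  shows "\<exists>p\<^sub>0::nat. \<forall>p::nat. prime p \<and> p \<ge> p\<^sub>0 \<longrightarrow>
    (let T = totient (p - 1) - 1;
         L = linear_complexity (primroot_sequence p)
     in L \<ge> Min ((\<lambda>q. ord q 2) ` prime_factors T) + (if [p = 1] (mod 4) then 1 else 0) \<and>
        (prime T \<and> residue_primroot T 2 \<longrightarrow>
           ([p = 1] (mod 4) \<longrightarrow> L = T) \<and>
           ([p = 3] (mod 4) \<longrightarrow> L \<ge> T - 1)))"
proof -
  obtain p1 where p1: "\<And>p. p \<ge> p1 \<Longrightarrow>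
      101 * ((real (card (prime_factors (p - 1))) + 1)\<^sup>2 * 4 ^ card (prime_factors (p - 1))) \<le> sqrt (real p)"
    using eventually_prime_factors_small by blast
  show ?thesis
    unfolding Let_def
  proof (intro exI[of _ "max 11 p1"] allI impI, elim conjE)
    fix p :: nat assume p: "prime p" "max 11 p1 \<le> p"
    define T where "T = totient (p - 1) - 1"
    define L where "L = linear_complexity (primroot_sequence p)"
    have LT: "L \<le> T" and "\<exists>q\<in>prime_factors T. ord q 2 + of_bool ([p = 1] (mod 4)) \<le> L"
      using primroot_sequence_lower_bound[OF p(1) _ p1] p(2) by (auto simp: T_def L_def)
    then obtain q where q: "q \<in> prime_factors T" "ord q 2 + of_bool ([p = 1] (mod 4)) \<le> L" by blast
    have "Min ((\<lambda>q. ord q 2) ` prime_factors T) \<le> ord q 2" using q(1) by (intro Min_le) auto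
    then have "Min ((\<lambda>q. ord q 2) ` prime_factors T) + (if [p = 1] (mod 4) then 1 else 0) \<le> L"
      using q(2) by (cases "[p = 1] (mod 4)") auto
    moreover have "([p = 1] (mod 4) \<longrightarrow> L = T) \<and> ([p = 3] (mod 4) \<longrightarrow> L \<ge> T - 1)"
      if "prime T" "residue_primroot T 2"
    proof -
      \<comment> \<open>A prime \<open>T\<close> leaves only this choice of \<open>q\<close>, and
        the order of 2 is then \<open>T - 1\<close>. For \<open>p\<close> congruent to 1 modulo 4
        the extra 1 meets the upper bound \<open>T\<close>.\<close>
      have "q = T" using q(1) that(1) by (simp add: prime_prime_factors)
      then have "ord q 2 = T - 1" using that by (simp add: residue_primroot_def totient_prime)
      then show ?thesis using q(2) LT prime_gt_0_nat[OF that(1)] by auto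
    qed
    ultimately show "Min ((\<lambda>q. ord q 2) ` prime_factors (totient (p - 1) - 1)) + (if [p = 1] (mod 4) then 1 else 0)
        \<le> linear_complexity (primroot_sequence p) \<and>
      (prime (totient (p - 1) - 1) \<and> residue_primroot (totient (p - 1) - 1) 2 \<longrightarrow>
        ([p = 1] (mod 4) \<longrightarrow> linear_complexity (primroot_sequence p) = totient (p - 1) - 1) \<and>
        ([p = 3] (mod 4) \<longrightarrow> totient (p - 1) - 1 - 1 \<le> linear_complexity (primroot_sequence p)))"
      unfolding T_def[symmetric] L_def[symmetric] by blast
  qed
qed

end
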